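(* Let $\mathcal{G}$ be a connected undirected graph on nodes $\{1,\dots,N\}$ with adjacency matrix $\mathbf{A}=[a_{ij}]$ ($a_{ij}=a_{ji}=1$ if $i,j$ are adjacent, $0$ otherwise, $a_{ii}=0$). Let $f^1,\dots,f^N:\mathbb{R}^d\to\mathbb{R}$ be twice continuously differentiable with $\underline{m}^i\mathbf{I}\preceq\mathbf{H}^i(\mathbf{x})\preceq\bar m^i\mathbf{I}$ for all $\mathbf{x}$, for constants $0<\underline{m}^i\le\bar m^i$, where $\mathbf{g}^i=\nabla f^i$, $\mathbf{H}^i=\nabla^2 f^i$, and let $\mathbf{x}^\star$ be the unique minimizer of $f=\sum_{i=1}^N f^i$ over $\mathbb{R}^d$. Consider the distributed HISO algorithm, for $i=1,\dots,N$, $$\mathbf{z}^i=\mathbf{g}^i(\mathbf{x}^i)+\mathbf{v}^i,$$ $$\dot{\mathbf{v}}^i=-\sum_{j=1}^N a_{ij}\,\mathrm{sgn}(\mathbf{z}^i-\mathbf{z}^j)+\sum_{j=1}^N a_{ij}(\mathbf{x}^i-\mathbf{x}^j),$$ $$\dot{\mathbf{x}}^i=-\mathbf{H}^i(\mathbf{x}^i)^{-1}\Big(\mathbf{z}^i+\sum_{j=1}^N a_{ij}(\mathbf{x}^i-\mathbf{x}^j)\Big),$$ with solutions understood in the sense of Filippov. Then, for any initial conditions $\mathbf{x}^i(0),\mathbf{v}^i(0)\in\mathbb{R}^d$ satisfying $\sum_{i=1}^N\mathbf{v}^i(0)=\mathbf{0}$, every $\mathbf{x}^i(t)$ converges to $\mathbf{x}^\star$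 and every $\mathbf{z}^i(t)$ converges to $\mathbf{0}$ as $t\to\infty$.
   Context: $\mathrm{sgn}$ is applied componentwise to vectors in $\mathbb{R}^d$. $\mathbf{I}$ is the $d\times d$ identity and $\preceq$ the Loewner order. *)

theory Defs
  imports "HOL-Analysis.Analysis"
begin

definition vsgn :: "real^'d \<Rightarrow> real^'d" where
  "vsgn z = (\<chi> k. sgn (z $ k))"

definition loewner_le :: "real^'d^'d \<Rightarrow> real^'d^'d \<Rightarrow> bool" where
  "loewner_le A B \<longleftrightarrow> (\<forall>y. y \<bullet> (A *v y) \<le> y \<bullet> (B *v y))"

definition abs_continuous_on :: "real \<Rightarrow> real \<Rightarrow> (real \<Rightarrow> 'a::real_normed_vector) \<Rightarrow> bool" where
  "abs_continuous_on a b y \<longleftrightarrow>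
    (\<forall>\<epsilon>>0. \<exists>\<delta>>0. \<forall>(n::nat) (s::nat \<Rightarrow> real) (t::nat \<Rightarrow> real).
       (\<forall>k<n. a \<le> s k \<and> s k \<le> t k \<and> t k \<le> b) \<and>
       (\<forall>k<n. \<forall>l<n. k \<noteq> l \<longrightarrow> t k \<le> s l \<or> t l \<le> s k) \<and>
       (\<Sum>k<n. t k - s k) < \<delta>
       \<longrightarrow> (\<Sum>k<n. norm (y (t k) - y (s k))) < \<epsilon>)"

definition filippov :: "('a::euclidean_space \<Rightarrow> 'a) \<Rightarrow> 'a \<Rightarrow> 'a set" where
  "filippov F y = (\<Inter>\<delta>\<in>{0<..}. \<Inter>S\<in>null_sets lebesgue. closure (convex hull (F ` (ball y \<delta> - S))))"

definition filippov_solution :: "('a::euclidean_space \<Rightarrow> 'a) \<Rightarrow> (real \<Rightarrow> 'a) \<Rightarrow> bool" where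
  "filippov_solution F y \<longleftrightarrow>
    (\<forall>T>0. abs_continuous_on 0 T y) \<and>
    (\<exists>Z\<in>null_sets lebesgue. \<forall>t\<in>{0<..} - Z.
        \<exists>y'. (y has_vector_derivative y') (at t) \<and> y' \<in> filippov F (y t))"

definition graph_connected :: "('n \<Rightarrow> 'n \<Rightarrow> real) \<Rightarrow> bool" where
  "graph_connected a \<longleftrightarrow> (\<forall>i j. (\<lambda>p q. a p q = 1)\<^sup>*\<^sup>* i j)"

definition hiso_z :: "('n::finite \<Rightarrow> real^'d \<Rightarrow> real^'d) \<Rightarrow> real^'d^'n \<Rightarrow> real^'d^'n \<Rightarrow> 'n \<Rightarrow> real^'d" where
  "hiso_z g x v i = g i (x $ i) + v $ i"

definition hiso_field ::
  "('n::finite \<Rightarrow> 'n \<Rightarrow> real) \<Rightarrow> ('n \<Rightarrow> real^'d \<Rightarrow> real^'d) \<Rightarrow> ('n \<Rightarrow> real^'d \<Rightarrow> real^'d^'d)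
   \<Rightarrow> (real^'d::finite^'n) \<times> (real^'d^'n) \<Rightarrow> (real^'d^'n) \<times> (real^'d^'n)" where
  "hiso_field a g H s = (let x = fst s; v = snd s; z = hiso_z g x v in
     ((\<chi> i. - (matrix_inv (H i (x $ i)) *v (z i + (\<Sum>j\<in>UNIV. a i j *\<^sub>R (x $ i - x $ j))))),
      (\<chi> i. - (\<Sum>j\<in>UNIV. a i j *\<^sub>R vsgn (z i - z j)) + (\<Sum>j\<in>UNIV. a i j *\<^sub>R (x $ i - x $ j)))))"

end

theory Submission
  imports Defs
begin

text \<open>
  Along a solution the coupling terms cancel in \<open>z\<close>, which obeys
  \<open>z\<^sub>i' = - z\<^sub>i - (\<Sum>j. a i j sgn (z\<^sub>i - z\<^sub>j))\<close>, so \<open>V = (\<Sum>i. |z\<^sub>i|\<^sup>2)\<close> satisfies \<open>V' \<le> - 2 V\<close>;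
  moreover \<open>\<Sum>i. v\<^sub>i\<close> stays \<open>0\<close>, so \<open>\<Sum>i. g\<^sub>i x\<^sub>i = \<Sum>i. z\<^sub>i\<close>.
  For the Bregman divergences \<open>W = (\<Sum>i. D\<^sub>i (x\<^sup>*, x\<^sub>i))\<close> one gets
  \<open>W' = (\<Sum>i. z\<^sub>i \<bullet> (x\<^sup>* - x\<^sub>i)) - Q / 2\<close> with \<open>Q = (\<Sum>i j. a i j |x\<^sub>i - x\<^sub>j|\<^sup>2)\<close>.
  By connectedness and strong monotonicity of the gradients,
  \<open>(\<Sum>i. |x\<^sub>i - x\<^sup>*|\<^sup>2) \<le> C Q + D V\<close>; hence \<open>U = W + c V\<close> with suitable \<open>c\<close> satisfies \<open>U' \<le> - \<kappa> U\<close>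
  almost everywhere, and absolute continuity turns this into \<open>U \<longrightarrow> 0\<close>.
\<close>

subsection \<open>Absolutely continuous functions\<close>

text \<open>The definition numbers its intervals by naturals, whereas a tagged division yields a
  family over an arbitrary finite set; a bijection with \<open>{..<card P}\<close> reindexes
  it.\<close>

lemma abs_continuous_on_finite_family:
  assumes ac: "abs_continuous_on a b y" and "0 < \<epsilon>"
  obtains \<delta> where "0 < \<delta>"
    "\<And>P l u. \<lbrakk>finite P; \<And>p. p \<in> P \<Longrightarrow> a \<le> l p \<and> l p \<le> u p \<and> u p \<le> b;
        \<And>p q. \<lbrakk>p \<in> P; q \<in> P; p \<noteq> q\<rbrakk> \<Longrightarrow> u p \<le> l q \<or> u q \<le> l p;
        (\<Sum>p\<in>P. u p - l p) < \<delta>\<rbrakk> \<Longrightarrow> (\<Sum>p\<in>P. norm (y (u p) - y (l p))) < \<epsilon>"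
proof -
  obtain \<delta> where "\<delta> > 0" and \<delta>: "\<forall>(n::nat) (s::nat \<Rightarrow> real) (t::nat \<Rightarrow> real).
       (\<forall>k<n. a \<le> s k \<and> s k \<le> t k \<and> t k \<le> b) \<and>
       (\<forall>k<n. \<forall>l<n. k \<noteq> l \<longrightarrow> t k \<le> s l \<or> t l \<le> s k) \<and>
       (\<Sum>k<n. t k - s k) < \<delta>
       \<longrightarrow> (\<Sum>k<n. norm (y (t k) - y (s k))) < \<epsilon>"
    using ac[unfolded abs_continuous_on_def, THEN spec, THEN mp, OF \<open>0 < \<epsilon>\<close>]
    by (elim exE conjE) (rule that)
  show thesis
  proof (rule that[OF \<open>\<delta> > 0\<close>])
    fix P :: "'c set" and l u :: "'c \<Rightarrow> real"
    assume fin: "finite P" and rng: "\<And>p. p \<in> P \<Longrightarrow> a \<le> l p \<and> l p \<le> u p \<and> u p \<le> b"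
      and dis: "\<And>p q. \<lbrakk>p \<in> P; q \<in> P; p \<noteq> q\<rbrakk> \<Longrightarrow> u p \<le> l q \<or> u q \<le> l p"
      and len: "(\<Sum>p\<in>P. u p - l p) < \<delta>"
    obtain h where h: "bij_betw h {..<card P} P"
      using ex_bij_betw_nat_finite[OF fin] by (auto simp: atLeast0LessThan)
    have mem: "h k \<in> P" if "k < card P" for k
      using h that by (auto simp: bij_betw_def)
    have inj: "h k \<noteq> h m" if "k < card P" "m < card P" "k \<noteq> m" for k m
      using h that by (auto simp: bij_betw_def inj_on_def)
    have "(\<Sum>k<card P. norm (y (u (h k)) - y (l (h k)))) < \<epsilon>"
    proof (rule \<delta>[rule_format], intro conjI allI impI)
      show "(\<Sum>k<card P. u (h k) - l (h k)) < \<delta>"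
        using len by (simp add: sum.reindex_bij_betw[OF h, of "\<lambda>p. u p - l p"])
    qed (use rng mem dis inj in blast)+
    then show "(\<Sum>p\<in>P. norm (y (u p) - y (l p))) < \<epsilon>"
      by (simp add: sum.reindex_bij_betw[OF h, of "\<lambda>p. norm (y (u p) - y (l p))"])
  qed
qed

text \<open>Because \<open>t\<close> lies between \<open>u\<close> and \<open>v\<close>, the
  first-order errors \<open>e * (t - u)\<close> and \<open>e * (v - t)\<close> add up to exactly
  \<open>e * (v - u)\<close>. Tagged intervals contain their tag in this way.\<close>

lemma DERIV_le_straddle:
  fixes \<phi> :: "real \<Rightarrow> real"
  assumes "(\<phi> has_real_derivative D) (at t)" "D \<le> c" "0 < e"
  obtains r where "0 < r"
    "\<And>u v. \<lbrakk>u \<le> t; t \<le> v; \<bar>u - t\<bar> < r; \<bar>v - t\<bar> < r\<rbrakk> \<Longrightarrow> \<phi> v - \<phi> u \<le> (c + e) * (v - u)"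
proof -
  obtain r where "r > 0" and r: "\<And>s. \<bar>s - t\<bar> < r \<Longrightarrow> \<bar>\<phi> s - \<phi> t - D * (s - t)\<bar> \<le> e * \<bar>s - t\<bar>"
    using assms(1,3) unfolding has_field_derivative_def has_derivative_at_alt by (fastforce simp: mult.commute)
  show thesis
  proof (rule that[OF \<open>r > 0\<close>])
    fix u v assume "u \<le> t" "t \<le> v" and "\<bar>u - t\<bar> < r" "\<bar>v - t\<bar> < r"
    then have "\<phi> v - \<phi> t - D * (v - t) \<le> e * (v - t)" "- (\<phi> u - \<phi> t - D * (u - t)) \<le> e * (t - u)"
      using r[of u] r[of v] by (auto simp: abs_le_iff)
    then have "\<phi> v - \<phi> u \<le> (D + e) * (v - u)"
      by (simp add: algebra_simps)
    also have "\<dots> \<le> (c + e) * (v - u)"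
      using \<open>D \<le> c\<close> \<open>u \<le> t\<close> \<open>t \<le> v\<close> by (intro mult_right_mono) auto
    finally show "\<phi> v - \<phi> u \<le> (c + e) * (v - u)" .
  qed
qed

text \<open>On a division fine enough for the derivative, the intervals tagged in the exceptional null set lie
  in an open set of small measure, where absolute continuity makes their total increment small.\<close>

lemma abs_continuous_on_DERIV_le:
  fixes \<phi> :: "real \<Rightarrow> real"
  assumes ac: "abs_continuous_on a b \<phi>" and "a \<le> b"
    and Z: "Z \<in> null_sets lebesgue"
    and der: "\<And>t. t \<in> {a<..<b} - Z \<Longrightarrow> \<exists>D. (\<phi> has_real_derivative D) (at t) \<and> D \<le> c"
  shows "\<phi> b - \<phi> a \<le> c * (b - a)"
proof -
  have main: "\<phi> b - \<phi> a \<le> (c + e) * (b - a) + 2 * e" if "e > 0" for e :: real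
  proof -
    obtain \<delta> where "0 < \<delta>" and \<delta>:
      "\<And>(P :: (real \<times> real set) set) l u. \<lbrakk>finite P; \<And>p. p \<in> P \<Longrightarrow> a \<le> l p \<and> l p \<le> u p \<and> u p \<le> b;
        \<And>p q. \<lbrakk>p \<in> P; q \<in> P; p \<noteq> q\<rbrakk> \<Longrightarrow> u p \<le> l q \<or> u q \<le> l p;
        (\<Sum>p\<in>P. u p - l p) < \<delta>\<rbrakk> \<Longrightarrow> (\<Sum>p\<in>P. norm (\<phi> (u p) - \<phi> (l p))) < e"
      by (fact abs_continuous_on_finite_family[OF ac \<open>e > 0\<close>])
    \<comment> \<open>The endpoints join the exceptional set because derivatives are given only in
      the open interval.\<close>
    define Z' where "Z' = Z \<union> {a,b}"
    have negl: "negligible Z'"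
      using Z by (simp add: Z'_def negligible_iff_null_sets)
    \<comment> \<open>The total length of the bad intervals will be below \<eta>: the first bound
      triggers absolute continuity, the second keeps their share of the slope term below
      \<open>e\<close>.\<close>
    define \<eta> where "\<eta> = min \<delta> (e / (\<bar>c + e\<bar> + 1))"
    have "\<eta> > 0"
      using \<open>0 < \<delta>\<close> \<open>0 < e\<close> by (simp add: \<eta>_def)
    moreover have null: "Z' \<in> null_sets lebesgue" "Z' \<in> sets lebesgue"
      using negl by (auto simp: negligible_iff_null_sets)
    ultimately obtain U where U: "open U" "Z' \<subseteq> U" "U - Z' \<in> lmeasurable"
        "emeasure lebesgue (U - Z') < ennreal \<eta>"
      using sets_lebesgue_outer_open by meson
    have Um: "U \<in> lmeasurable"
      using U null by (metis borel_open measurable_Diff_null_set sets_completionI_sets sets_lborel)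
    have "measure lebesgue (U - Z') < \<eta>"
      using U(3,4) \<open>\<eta> > 0\<close> by (metis emeasure_eq_measure2 ennreal_leI linorder_not_le)
    then have U\<eta>: "measure lebesgue U < \<eta>"
      using null Um by (simp add: measure_Diff_null_set fmeasurableD)
    have "\<exists>r>0. (t \<in> Z' \<longrightarrow> ball t r \<subseteq> U) \<and> (t \<in> {a..b} - Z' \<longrightarrow>
        (\<forall>u v. u \<le> t \<longrightarrow> t \<le> v \<longrightarrow> \<bar>u - t\<bar> < r \<longrightarrow> \<bar>v - t\<bar> < r \<longrightarrow> \<phi> v - \<phi> u \<le> (c + e) * (v - u)))" for t
    proof (cases "t \<in> Z'")
      case True
      then show ?thesis
        using U(1,2) openE by blast
    next
      case False
      show ?thesis
      proof (cases "t \<in> {a..b}")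
        case True
        with False have "t \<in> {a<..<b} - Z"
          by (auto simp: Z'_def)
        then obtain D where "(\<phi> has_real_derivative D) (at t)" "D \<le> c"
          using der by blast
        from DERIV_le_straddle[OF this \<open>e > 0\<close>] show ?thesis
          using False by metis
      qed (use False zero_less_one in blast)
    qed
    then obtain r where r0: "\<And>t. r t > 0" and rU: "\<And>t. t \<in> Z' \<Longrightarrow> ball t (r t) \<subseteq> U"
      and rD: "\<And>t u v. \<lbrakk>t \<in> {a..b} - Z'; u \<le> t; t \<le> v; \<bar>u - t\<bar> < r t; \<bar>v - t\<bar> < r t\<rbrakk>
         \<Longrightarrow> \<phi> v - \<phi> u \<le> (c + e) * (v - u)"
      by metis
    have "gauge (\<lambda>t. ball t (r t))"
      using r0 by (simp add: gauge_def)
    then obtain p where p: "p tagged_division_of {a..b}" and fine: "(\<lambda>t. ball t (r t)) fine p"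
      using fine_division_exists_real by blast
    have iv: "K = {Inf K..Sup K} \<and> Inf K \<le> t \<and> t \<le> Sup K \<and> a \<le> Inf K \<and> Sup K \<le> b" if tK: "(t,K) \<in> p" for t K
    proof -
      obtain u v where K: "K = {u..v}"
        using tagged_division_ofD(4)[OF p tK] by auto
      moreover have "t \<in> K" "K \<subseteq> {a..b}"
        using tagged_division_ofD(2,3)[OF p tK] by auto
      ultimately have "u \<le> v" "Inf K = u" "Sup K = v"
        by auto
      then show ?thesis
        using \<open>t \<in> K\<close> \<open>K \<subseteq> {a..b}\<close> K by auto
    qed
    have finp: "finite p" using p by auto
    \<comment> \<open>Degenerate intervals are left out: they contribute nothing to the sums, but
      one may sit inside another interval, which breaks the ordering of endpoints that \<delta>
      requires.\<close>
    define P where "P = {q \<in> p. fst q \<in> Z' \<and> Inf (snd q) < Sup (snd q)}"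
    have finP: "finite P" and Pp: "P \<subseteq> p" using finp by (auto simp: P_def)
    have sep: "interior (snd q) \<inter> interior (snd q') = {}" if "q \<in> p" "q' \<in> p" "q \<noteq> q'" for q q'
      using tagged_division_ofD(5)[OF p, of "fst q" "snd q" "fst q'" "snd q'"] that by auto
    have int: "interior (snd q) = {Inf (snd q)<..<Sup (snd q)}" if "q \<in> p" for q
      using iv[of "fst q" "snd q"] that
      by (metis interior_atLeastAtMost_real prod.collapse)
    have dis: "Sup (snd q) \<le> Inf (snd q') \<or> Sup (snd q') \<le> Inf (snd q)"
      if "q \<in> P" "q' \<in> P" "q \<noteq> q'" for q q'
    proof (rule ccontr)
      assume "\<not> ?thesis"
      then have "max (Inf (snd q)) (Inf (snd q')) < min (Sup (snd q)) (Sup (snd q'))"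
        using that by (auto simp: P_def)
      then obtain s where "max (Inf (snd q)) (Inf (snd q')) < s" "s < min (Sup (snd q)) (Sup (snd q'))"
        using dense by blast
      then have "s \<in> interior (snd q) \<inter> interior (snd q')"
        using int[of q] int[of q'] that Pp by auto
      then show False using sep that Pp by blast
    qed
    have "(\<Sum>q\<in>P. Sup (snd q) - Inf (snd q)) = (\<Sum>q\<in>P. measure lebesgue (interior (snd q)))"
    proof (rule sum.cong)
      fix q assume "q \<in> P"
      then show "Sup (snd q) - Inf (snd q) = measure lebesgue (interior (snd q))"
        using int[of q] Pp by (auto simp: P_def)
    qed simp
    also have "\<dots> = measure lebesgue (\<Union>q\<in>P. interior (snd q))"
    proof (rule measure_finite_Union[symmetric])
      show "disjoint_family_on (\<lambda>q. interior (snd q)) P"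
        unfolding disjoint_family_on_def using sep Pp by blast
      show "emeasure lebesgue (interior (snd q)) \<noteq> \<infinity>" if "q \<in> P" for q
      proof -
        have "q \<in> p" using that Pp by auto
        then show ?thesis using int[of q] that by (auto simp: P_def)
      qed
    qed (use finP in auto)
    also have "\<dots> \<le> measure lebesgue U"
    proof (rule measure_mono_fmeasurable)
      show "(\<Union>q\<in>P. interior (snd q)) \<subseteq> U"
      proof (rule UN_least)
        fix q assume "q \<in> P"
        then have "snd q \<subseteq> ball (fst q) (r (fst q))" "fst q \<in> Z'"
          using fine Pp by (auto simp: fine_def P_def case_prod_beta)
        then show "interior (snd q) \<subseteq> U"
          using rU interior_subset by (meson subset_trans)
      qed
      show "(\<Union>q\<in>P. interior (snd q)) \<in> sets lebesgue"
        using finP by (intro sets.finite_UN) auto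
    qed (rule Um)
    finally have len: "(\<Sum>q\<in>P. Sup (snd q) - Inf (snd q)) < \<eta>"
      using U\<eta> by linarith
    have ivP: "a \<le> Inf (snd q) \<and> Inf (snd q) \<le> Sup (snd q) \<and> Sup (snd q) \<le> b" if "q \<in> p" for q
      using iv[of "fst q" "snd q"] that by auto
    have bad: "(\<Sum>q\<in>P. norm (\<phi> (Sup (snd q)) - \<phi> (Inf (snd q)))) < e"
      using finP ivP dis len Pp by (intro \<delta>) (auto simp: \<eta>_def)
    define J where "J = (\<lambda>q::real \<times> real set. \<phi> (Sup (snd q)) - \<phi> (Inf (snd q)))"
    define L where "L = (\<lambda>q::real \<times> real set. Sup (snd q) - Inf (snd q))"
    \<comment> \<open>Off \<open>P\<close> the slope bound holds as it stands; on \<open>P\<close>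
      the correction term swaps it for the raw increment.\<close>
    have "J q \<le> (c + e) * L q + (if q \<in> P then norm (J q) - (c + e) * L q else 0)" if "q \<in> p" for q
    proof (cases "fst q \<in> Z'")
      case True
      then show ?thesis
        using ivP[OF that] that by (auto simp: P_def J_def L_def)
    next
      case False
      have fq: "snd q \<subseteq> ball (fst q) (r (fst q))"
        using fine that by (auto simp: fine_def case_prod_beta)
      have *: "snd q = {Inf (snd q)..Sup (snd q)}" "Inf (snd q) \<le> fst q" "fst q \<le> Sup (snd q)"
        "a \<le> Inf (snd q)" "Sup (snd q) \<le> b"
        using iv[of "fst q" "snd q"] that by auto
      have "Inf (snd q) \<in> snd q" "Sup (snd q) \<in> snd q"
        using * by (metis atLeastAtMost_iff order.trans order.refl)+
      then have "\<bar>Inf (snd q) - fst q\<bar> < r (fst q)" "\<bar>Sup (snd q) - fst q\<bar> < r (fst q)"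
        using fq by (auto simp: subset_iff dist_real_def abs_minus_commute)
      then have "J q \<le> (c + e) * L q"
        unfolding J_def L_def using False * by (intro rD[of "fst q"]) auto
      then show ?thesis using False by (auto simp: P_def)
    qed
    then have "sum J p \<le> (\<Sum>q\<in>p. (c + e) * L q + (if q \<in> P then norm (J q) - (c + e) * L q else 0))"
      by (rule sum_mono)
    also have "\<dots> = (c + e) * sum L p + (\<Sum>q\<in>P. norm (J q)) - (c + e) * sum L P"
      using finp Pp by (simp add: sum.distrib sum_distrib_left sum.inter_restrict[symmetric] sum_subtractf Int_absorb1)
    finally have 1: "sum J p \<le> (c + e) * sum L p + (\<Sum>q\<in>P. norm (J q)) - (c + e) * sum L P" .
    have 2: "sum J p = \<phi> b - \<phi> a" "sum L p = b - a"
      using additive_tagged_division_1[OF \<open>a \<le> b\<close> p, of \<phi>] additive_tagged_division_1[OF \<open>a \<le> b\<close> p, of "\<lambda>x. x"]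
      by (auto simp: J_def L_def case_prod_beta)
    \<comment> \<open>\<open>c + e\<close> may be negative, so dropping the bad intervals from the
      slope term can raise it, but by the choice of \<eta> by at most \<open>e\<close>. This is the
      second \<open>e\<close> in the claim.\<close>
    have "0 \<le> sum L P"
      using ivP Pp by (intro sum_nonneg) (auto simp: L_def)
    then have "(- (c + e)) * sum L P \<le> (\<bar>c + e\<bar> + 1) * sum L P"
      by (intro mult_right_mono) auto
    then have "- ((c + e) * sum L P) \<le> (\<bar>c + e\<bar> + 1) * sum L P"
      by (simp only: mult_minus_left)
    also have "\<dots> \<le> e"
    proof -
      have "sum L P < e / (\<bar>c + e\<bar> + 1)"
        using len by (simp add: L_def \<eta>_def)
      then show ?thesis
        by (simp add: field_simps)
    qed
    finally show ?thesis
      using 1[unfolded 2] bad unfolding J_def by linarith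
  qed
  have "((\<lambda>e. (c + e) * (b - a) + 2 * e) \<longlongrightarrow> (c + 0) * (b - a) + 2 * 0) (at_right 0)"
    by (intro tendsto_intros)
  moreover have "\<forall>\<^sub>F e in at_right 0. \<phi> b - \<phi> a \<le> (c + e) * (b - a) + 2 * e"
    by (rule eventually_mono[OF eventually_at_right_less main])
  ultimately have "\<phi> b - \<phi> a \<le> (c + 0) * (b - a) + 2 * 0"
    using tendsto_lowerbound trivial_limit_at_right_real by blast
  then show ?thesis by simp
qed

section \<open>Closure properties of absolute continuity\<close>

lemma abs_continuous_on_subinterval:
  assumes "abs_continuous_on a b y" "a \<le> c" "d \<le> b"
  shows "abs_continuous_on c d y"
  unfolding abs_continuous_on_def
proof (intro allI impI)
  fix \<epsilon> :: real assume "\<epsilon> > 0"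
  then obtain \<delta> where "\<delta> > 0" and \<delta>: "\<forall>(n::nat) (s::nat \<Rightarrow> real) (t::nat \<Rightarrow> real).
       (\<forall>k<n. a \<le> s k \<and> s k \<le> t k \<and> t k \<le> b) \<and>
       (\<forall>k<n. \<forall>l<n. k \<noteq> l \<longrightarrow> t k \<le> s l \<or> t l \<le> s k) \<and>
       (\<Sum>k<n. t k - s k) < \<delta> \<longrightarrow> (\<Sum>k<n. norm (y (t k) - y (s k))) < \<epsilon>"
    using assms(1)[unfolded abs_continuous_on_def, THEN spec, THEN mp, OF \<open>\<epsilon> > 0\<close>]
    by (elim exE conjE) (rule that)
  show "\<exists>\<delta>>0. \<forall>(n::nat) (s::nat \<Rightarrow> real) (t::nat \<Rightarrow> real).
       (\<forall>k<n. c \<le> s k \<and> s k \<le> t k \<and> t k \<le> d) \<and>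
       (\<forall>k<n. \<forall>l<n. k \<noteq> l \<longrightarrow> t k \<le> s l \<or> t l \<le> s k) \<and>
       (\<Sum>k<n. t k - s k) < \<delta> \<longrightarrow> (\<Sum>k<n. norm (y (t k) - y (s k))) < \<epsilon>"
  proof (intro exI[of _ \<delta>] conjI allI impI, goal_cases)
    case (2 n s t)
    then show ?case
      using \<open>a \<le> c\<close> \<open>d \<le> b\<close> by (intro \<delta>[rule_format]) fastforce
  qed (rule \<open>\<delta> > 0\<close>)
qed

text \<open>The comparison principle behind Lipschitz images, sums, differences and inner products:
  increments of \<open>w\<close> are summed against those of \<open>y\<close> and \<open>z\<close>
  over the same intervals.\<close>

lemma abs_continuous_on_dominated:
  assumes y: "abs_continuous_on a b y" and z: "abs_continuous_on a b z"
    and dom: "\<And>s t. \<lbrakk>s \<in> {a..b}; t \<in> {a..b}\<rbrakk>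
      \<Longrightarrow> norm (w t - w s) \<le> K * (norm (y t - y s) + norm (z t - z s))"
  shows "abs_continuous_on a b w"
  unfolding abs_continuous_on_def
proof (intro allI impI)
  fix \<epsilon> :: real assume "\<epsilon> > 0"
  \<comment> \<open>Each of the two sums gets \<open>e\<close>; \<open>\<bar>K\<bar> + 1\<close> is
    positive whatever the sign of \<open>K\<close>.\<close>
  define e where "e = \<epsilon> / (2 * (\<bar>K\<bar> + 1))"
  have "e > 0" using \<open>\<epsilon> > 0\<close> by (simp add: e_def)
  obtain \<delta>1 where "\<delta>1 > 0" and \<delta>1: "\<forall>(n::nat) (s::nat \<Rightarrow> real) (t::nat \<Rightarrow> real).
       (\<forall>k<n. a \<le> s k \<and> s k \<le> t k \<and> t k \<le> b) \<and>
       (\<forall>k<n. \<forall>l<n. k \<noteq> l \<longrightarrow> t k \<le> s l \<or> t l \<le> s k) \<and>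
       (\<Sum>k<n. t k - s k) < \<delta>1 \<longrightarrow> (\<Sum>k<n. norm (y (t k) - y (s k))) < e"
    using y[unfolded abs_continuous_on_def, THEN spec, THEN mp, OF \<open>e > 0\<close>]
    by (elim exE conjE) (rule that)
  obtain \<delta>2 where "\<delta>2 > 0" and \<delta>2: "\<forall>(n::nat) (s::nat \<Rightarrow> real) (t::nat \<Rightarrow> real).
       (\<forall>k<n. a \<le> s k \<and> s k \<le> t k \<and> t k \<le> b) \<and>
       (\<forall>k<n. \<forall>l<n. k \<noteq> l \<longrightarrow> t k \<le> s l \<or> t l \<le> s k) \<and>
       (\<Sum>k<n. t k - s k) < \<delta>2 \<longrightarrow> (\<Sum>k<n. norm (z (t k) - z (s k))) < e"
    using z[unfolded abs_continuous_on_def, THEN spec, THEN mp, OF \<open>e > 0\<close>]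
    by (elim exE conjE) (rule that)
  show "\<exists>\<delta>>0. \<forall>(n::nat) (s::nat \<Rightarrow> real) (t::nat \<Rightarrow> real).
       (\<forall>k<n. a \<le> s k \<and> s k \<le> t k \<and> t k \<le> b) \<and>
       (\<forall>k<n. \<forall>l<n. k \<noteq> l \<longrightarrow> t k \<le> s l \<or> t l \<le> s k) \<and>
       (\<Sum>k<n. t k - s k) < \<delta> \<longrightarrow> (\<Sum>k<n. norm (w (t k) - w (s k))) < \<epsilon>"
  proof (intro exI[of _ "min \<delta>1 \<delta>2"] conjI allI impI, goal_cases)
    case 1
    show ?case using \<open>\<delta>1 > 0\<close> \<open>\<delta>2 > 0\<close> by simp
  next
    case (2 n s t)
    have "(\<Sum>k<n. norm (y (t k) - y (s k))) < e" "(\<Sum>k<n. norm (z (t k) - z (s k))) < e"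
      using 2 \<delta>1 \<delta>2 by auto
    then have lt: "(\<Sum>k<n. norm (y (t k) - y (s k)) + norm (z (t k) - z (s k))) < 2 * e"
      by (simp add: sum.distrib)
    have "(\<Sum>k<n. norm (w (t k) - w (s k)))
        \<le> (\<Sum>k<n. (\<bar>K\<bar> + 1) * (norm (y (t k) - y (s k)) + norm (z (t k) - z (s k))))"
    proof (rule sum_mono)
      fix k assume "k \<in> {..<n}"
      then have "s k \<in> {a..b}" "t k \<in> {a..b}" using 2 by force+
      from dom[OF this] show "norm (w (t k) - w (s k))
          \<le> (\<bar>K\<bar> + 1) * (norm (y (t k) - y (s k)) + norm (z (t k) - z (s k)))"
        by (rule order_trans) (intro mult_right_mono, auto)
    qed
    also have "\<dots> < (\<bar>K\<bar> + 1) * (2 * e)"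
      unfolding sum_distrib_left[symmetric] using lt by (intro mult_strict_left_mono) auto
    also have "\<dots> = \<epsilon>" by (simp add: e_def field_simps)
    finally show ?case .
  qed
qed

lemma abs_continuous_on_lipschitz:
  assumes "abs_continuous_on a b y"
    and "\<And>s t. \<lbrakk>s \<in> {a..b}; t \<in> {a..b}\<rbrakk> \<Longrightarrow> norm (w t - w s) \<le> K * norm (y t - y s)"
  shows "abs_continuous_on a b w"
\<comment> \<open>\<open>y\<close> fills both slots, so its increment counts twice and the constant
  is halved.\<close>
proof (rule abs_continuous_on_dominated[OF assms(1,1), where K = "K / 2"])
qed (use assms(2) in auto)

lemma abs_continuous_on_imp_continuous_on:
  assumes "abs_continuous_on a b y"
  shows "continuous_on {a..b} y"
  unfolding continuous_on_iff
proof (intro ballI allI impI)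
  fix t e :: real assume t: "t \<in> {a..b}" and "e > 0"
  obtain \<delta> where "\<delta> > 0" and \<delta>: "\<forall>(n::nat) (s::nat \<Rightarrow> real) (t::nat \<Rightarrow> real).
       (\<forall>k<n. a \<le> s k \<and> s k \<le> t k \<and> t k \<le> b) \<and>
       (\<forall>k<n. \<forall>l<n. k \<noteq> l \<longrightarrow> t k \<le> s l \<or> t l \<le> s k) \<and>
       (\<Sum>k<n. t k - s k) < \<delta> \<longrightarrow> (\<Sum>k<n. norm (y (t k) - y (s k))) < e"
    using assms[unfolded abs_continuous_on_def, THEN spec, THEN mp, OF \<open>e > 0\<close>]
    by (elim exE conjE) (rule that)
  have *: "dist (y u) (y v) < e" if "a \<le> u" "u \<le> v" "v \<le> b" "v - u < \<delta>" for u v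
    using \<delta>[rule_format, of 1 "\<lambda>_. u" "\<lambda>_. v"] that by (simp add: dist_norm norm_minus_commute)
  show "\<exists>d>0. \<forall>s\<in>{a..b}. dist s t < d \<longrightarrow> dist (y s) (y t) < e"
  proof (intro exI[of _ \<delta>] conjI ballI impI)
    fix s assume "s \<in> {a..b}" "dist s t < \<delta>"
    then show "dist (y s) (y t) < e"
      using *[of s t] *[of t s] t by (cases "s \<le> t") (auto simp: dist_real_def dist_commute)
  qed (rule \<open>\<delta> > 0\<close>)
qed

lemma abs_continuous_on_bounded:
  assumes "abs_continuous_on a b y"
  obtains B where "\<And>t. t \<in> {a..b} \<Longrightarrow> norm (y t) \<le> B"
proof -
  have "bounded (y ` {a..b})"
    using abs_continuous_on_imp_continuous_on[OF assms] compact_continuous_image compact_imp_bounded by blast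
  then show thesis using that unfolding bounded_iff by blast
qed

lemma abs_continuous_on_const: "abs_continuous_on a b (\<lambda>t. c)"
  unfolding abs_continuous_on_def using zero_less_one by auto

lemma abs_continuous_on_add:
  assumes "abs_continuous_on a b y" "abs_continuous_on a b z"
  shows "abs_continuous_on a b (\<lambda>t. y t + z t)"
proof (rule abs_continuous_on_dominated[OF assms, where K = 1])
  show "norm (y t + z t - (y s + z s)) \<le> 1 * (norm (y t - y s) + norm (z t - z s))" for s t
    using norm_triangle_ineq[of "y t - y s" "z t - z s"] by (simp add: algebra_simps)
qed

lemma abs_continuous_on_diff:
  assumes "abs_continuous_on a b y" "abs_continuous_on a b z"
  shows "abs_continuous_on a b (\<lambda>t. y t - z t)"
proof (rule abs_continuous_on_dominated[OF assms, where K = 1])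
  show "norm (y t - z t - (y s - z s)) \<le> 1 * (norm (y t - y s) + norm (z t - z s))" for s t
    using norm_triangle_ineq4[of "y t - y s" "z t - z s"] by (simp add: algebra_simps)
qed

lemma abs_continuous_on_sum:
  assumes "\<And>i. i \<in> I \<Longrightarrow> abs_continuous_on a b (y i)"
  shows "abs_continuous_on a b (\<lambda>t. \<Sum>i\<in>I. y i t)"
  using assms by (induction I rule: infinite_finite_induct)
    (auto intro: abs_continuous_on_const abs_continuous_on_add)

text \<open>The increment splits bilinearly, and the factor left undifferenced is bounded because
  its continuous image of the compact interval is.\<close>

lemma abs_continuous_on_inner:
  fixes y z :: "real \<Rightarrow> 'a::real_inner"
  assumes "abs_continuous_on a b y" "abs_continuous_on a b z"
  shows "abs_continuous_on a b (\<lambda>t. y t \<bullet> z t)"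
proof -
  obtain B C where B: "\<And>t. t \<in> {a..b} \<Longrightarrow> norm (y t) \<le> B" and C: "\<And>t. t \<in> {a..b} \<Longrightarrow> norm (z t) \<le> C"
    using assms abs_continuous_on_bounded by metis
  show ?thesis
  proof (rule abs_continuous_on_dominated[OF assms, where K = "max B C"])
    fix s t assume st: "s \<in> {a..b}" "t \<in> {a..b}"
    have "norm (y t \<bullet> z t - y s \<bullet> z s) = \<bar>(y t - y s) \<bullet> z t + y s \<bullet> (z t - z s)\<bar>"
      by (simp add: algebra_simps)
    also have "\<dots> \<le> norm (y t - y s) * norm (z t) + norm (y s) * norm (z t - z s)"
      using Cauchy_Schwarz_ineq2[of "y t - y s" "z t"] Cauchy_Schwarz_ineq2[of "y s" "z t - z s"] by linarith
    also have "\<dots> \<le> norm (y t - y s) * max B C + max B C * norm (z t - z s)"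
      using B[OF st(1)] C[OF st(2)] by (intro add_mono mult_left_mono mult_right_mono) auto
    finally show "norm (y t \<bullet> z t - y s \<bullet> z s) \<le> max B C * (norm (y t - y s) + norm (z t - z s))"
      by (simp add: algebra_simps)
  qed
qed

section \<open>Decay from a differential inequality\<close>

text \<open>Since \<phi> is nonincreasing, its derivative on \<open>[0, t]\<close> is at most the
  constant \<open>- \<kappa> * \<phi> t\<close>. Integrating this gives
  \<open>\<phi> t * (1 + \<kappa> * t) \<le> \<phi> 0\<close>, a rate \<open>1 / t\<close> that
  suffices for the limit.\<close>

lemma abs_continuous_decay:
  fixes \<phi> :: "real \<Rightarrow> real"
  assumes ac: "\<And>T. T > 0 \<Longrightarrow> abs_continuous_on 0 T \<phi>"
    and nonneg: "\<And>t. 0 \<le> \<phi> t" and "0 < \<kappa>"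
    and Z: "Z \<in> null_sets lebesgue"
    and der: "\<And>t. t \<in> {0<..} - Z \<Longrightarrow> \<exists>D. (\<phi> has_real_derivative D) (at t) \<and> D \<le> - \<kappa> * \<phi> t"
  shows "(\<phi> \<longlongrightarrow> 0) at_top"
proof -
  have mono: "\<phi> t \<le> \<phi> s" if "0 \<le> s" "s \<le> t" for s t
  proof (cases "t = 0")
    case False
    have "\<phi> t - \<phi> s \<le> 0 * (t - s)"
    proof (rule abs_continuous_on_DERIV_le[OF _ \<open>s \<le> t\<close> Z])
      show "abs_continuous_on s t \<phi>"
        using ac[of t] that False by (auto intro: abs_continuous_on_subinterval)
      fix r assume "r \<in> {s<..<t} - Z"
      then obtain D where "(\<phi> has_real_derivative D) (at r)" "D \<le> - \<kappa> * \<phi> r"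
        using der[of r] \<open>0 \<le> s\<close> by auto
      moreover have "- \<kappa> * \<phi> r \<le> 0"
        using nonneg[of r] \<open>0 < \<kappa>\<close> by simp
      ultimately show "\<exists>D. (\<phi> has_real_derivative D) (at r) \<and> D \<le> 0"
        by force
    qed
    then show ?thesis by simp
  qed (use that in auto)
  have bound: "\<phi> t \<le> \<phi> 0 / (1 + \<kappa> * t)" if "t > 0" for t
  proof -
    have "\<phi> t - \<phi> 0 \<le> (- \<kappa> * \<phi> t) * (t - 0)"
    proof (rule abs_continuous_on_DERIV_le[OF ac[OF \<open>t > 0\<close>] _ Z])
      fix r assume r: "r \<in> {0<..<t} - Z"
      then obtain D where "(\<phi> has_real_derivative D) (at r)" "D \<le> - \<kappa> * \<phi> r"
        using der[of r] by auto
      moreover have "- \<kappa> * \<phi> r \<le> - \<kappa> * \<phi> t"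
        using mono[of r t] r \<open>0 < \<kappa>\<close> by simp
      ultimately show "\<exists>D. (\<phi> has_real_derivative D) (at r) \<and> D \<le> - \<kappa> * \<phi> t"
        by force
    qed (use that in simp)
    then have "\<phi> t * (1 + \<kappa> * t) \<le> \<phi> 0"
      by (simp add: algebra_simps)
    moreover have "0 < 1 + \<kappa> * t"
      using that \<open>0 < \<kappa>\<close> by (simp add: add_pos_pos)
    ultimately show ?thesis
      by (simp add: pos_le_divide_eq)
  qed
  have "filterlim (\<lambda>t. 1 + \<kappa> * t) at_top at_top"
    by (intro filterlim_tendsto_add_at_top[OF tendsto_const]
        filterlim_tendsto_pos_mult_at_top[OF tendsto_const \<open>0 < \<kappa>\<close>] filterlim_ident)
  then have lim: "((\<lambda>t. \<phi> 0 / (1 + \<kappa> * t)) \<longlongrightarrow> 0) at_top"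
    by (intro tendsto_divide_0[OF tendsto_const] filterlim_at_top_imp_at_infinity)
  show ?thesis
    by (rule tendsto_sandwich[OF _ _ tendsto_const lim])
      (auto intro: nonneg bound eventually_mono[OF eventually_gt_at_top[of 0]])
qed

lemma tendsto_0_of_sq_le:
  fixes y :: "'b \<Rightarrow> 'a::real_normed_vector"
  assumes "(\<phi> \<longlongrightarrow> 0) F" "\<And>t. (norm (y t))\<^sup>2 \<le> c * \<phi> t"
  shows "(y \<longlongrightarrow> 0) F"
proof (rule Lim_null_comparison)
  have "((\<lambda>t. sqrt (c * \<phi> t)) \<longlongrightarrow> sqrt (c * 0)) F"
    by (intro tendsto_intros assms(1))
  then show "((\<lambda>t. sqrt (c * \<phi> t)) \<longlongrightarrow> 0) F"
    by simp
  show "\<forall>\<^sub>F t in F. norm (y t) \<le> sqrt (c * \<phi> t)"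
    using assms(2) by (simp add: real_le_rsqrt)
qed

subsection \<open>Functions with bounded Hessian\<close>

text \<open>The data of one node, separated from the network; \<open>lo\<close> and
  \<open>hi\<close> are the Loewner bounds as bounds on quadratic forms.\<close>

locale bounded_hessian =
  fixes f :: "real^'d::finite \<Rightarrow> real" and g :: "real^'d \<Rightarrow> real^'d" and H :: "real^'d \<Rightarrow> real^'d^'d"
    and m M :: real
  assumes grad: "(f has_derivative (\<lambda>h. g y \<bullet> h)) (at y)"
    and hess: "(g has_derivative (\<lambda>h. H y *v h)) (at y)"
    and m_pos: "0 < m" and m_le: "m \<le> M"
    and lo: "m * (h \<bullet> h) \<le> h \<bullet> (H y *v h)"
    and hi: "h \<bullet> (H y *v h) \<le> M * (h \<bullet> h)"
begin

text \<open>The trajectory will enter in the second slot: differentiating there produces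
  \<open>H (x t) *v x'\<close>, in which the inverse Hessian of the algorithm cancels.\<close>

definition bregman :: "real^'d \<Rightarrow> real^'d \<Rightarrow> real" where
  "bregman p q = f p - f q - g q \<bullet> (p - q)"

text \<open>Second-order Taylor expansion with Lagrange remainder of \<open>f\<close> along the
  segment from \<open>q\<close> to \<open>p\<close>.\<close>

lemma bregman_eq_hessian:
  obtains \<xi> where "bregman p q = (p - q) \<bullet> (H \<xi> *v (p - q)) / 2"
proof -
  define d where "d = p - q"
  \<comment> \<open>\<open>Maclaurin\<close> expects a sequence of derivatives; from index 2 on the
    second derivative is repeated, and only indices 0, 1 and 2 are consulted.\<close>
  define D where "D = (\<lambda>n s. if n = 0 then f (q + s *\<^sub>R d) else if n = Suc 0 then g (q + s *\<^sub>R d) \<bullet> d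
     else d \<bullet> (H (q + s *\<^sub>R d) *v d))"
  have line: "((\<lambda>s. q + s *\<^sub>R d) has_derivative (\<lambda>s. s *\<^sub>R d)) (at t)" for t
    by (auto intro!: derivative_eq_intros)
  have "((\<lambda>s. f (q + s *\<^sub>R d)) has_real_derivative g (q + t *\<^sub>R d) \<bullet> d) (at t)" for t
    by (rule has_derivative_imp_has_field_derivative[OF has_derivative_compose[OF line grad]]) simp
  then have D0: "(D 0 has_real_derivative D (Suc 0) t) (at t)" for t
    by (simp add: D_def)
  have "((\<lambda>s. g (q + s *\<^sub>R d) \<bullet> d) has_real_derivative d \<bullet> (H (q + t *\<^sub>R d) *v d)) (at t)" for t
    by (rule has_derivative_imp_has_field_derivative[OF
          has_derivative_inner_left[OF has_derivative_compose[OF line hess]]])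
      (simp add: matrix_vector_mult_scaleR inner_commute)
  then have D1: "(D (Suc 0) has_real_derivative D (Suc (Suc 0)) t) (at t)" for t
    by (simp add: D_def)
  have "\<forall>k t. k < 2 \<and> 0 \<le> t \<and> t \<le> 1 \<longrightarrow> (D k has_real_derivative D (Suc k) t) (at t)"
    using D0 D1 by (auto simp: less_Suc_eq numeral_2_eq_2)
  from Maclaurin[OF _ _ _ this, of "D 0"] obtain t where
    "D 0 1 = (\<Sum>k<2. D k 0 / fact k * 1 ^ k) + D 2 t / fact 2 * 1\<^sup>2"
    by auto
  then have "bregman p q = d \<bullet> (H (q + t *\<^sub>R d) *v d) / 2"
    by (simp add: numeral_2_eq_2 D_def d_def bregman_def)
  then show thesis
    unfolding d_def by (rule that)
qed

lemma bregman_lower: "m / 2 * (norm (p - q))\<^sup>2 \<le> bregman p q"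
  and bregman_upper: "bregman p q \<le> M / 2 * (norm (p - q))\<^sup>2"
proof -
  obtain \<xi> where "bregman p q = (p - q) \<bullet> (H \<xi> *v (p - q)) / 2"
    using bregman_eq_hessian .
  then show "m / 2 * (norm (p - q))\<^sup>2 \<le> bregman p q" "bregman p q \<le> M / 2 * (norm (p - q))\<^sup>2"
    using lo[of "p - q" \<xi>] hi[of "p - q" \<xi>] by (auto simp: power2_norm_eq_inner)
qed

lemma bregman_nonneg: "0 \<le> bregman p q"
  using bregman_lower[of p q] m_pos by (smt (verit) zero_le_power2 mult_nonneg_nonneg divide_nonneg_nonneg)

text \<open>The right-hand side is \<open>bregman p q + bregman q p\<close>, and each summand is at
  least \<open>m / 2\<close> times the squared distance.\<close>

lemma gradient_strongly_monotone: "m * (norm (p - q))\<^sup>2 \<le> (g p - g q) \<bullet> (p - q)"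
  using bregman_lower[of p q] bregman_lower[of q p]
  by (simp add: bregman_def inner_diff norm_minus_commute algebra_simps)

text \<open>The matrices \<open>H y\<close> are not assumed symmetric, so the bound on their quadratic forms gives no
  operator norm directly; compare the quadratic upper model at \<open>p\<close> with the tangent plane at \<open>q\<close>
  in the point \<open>p - (g p - g q) / M\<close> instead.\<close>

lemma gradient_lipschitz: "norm (g p - g q) \<le> M * norm (p - q)"
proof -
  have "M > 0" using m_pos m_le by simp
  define d where "d = g p - g q"
  define r where "r = p - (1 / M) *\<^sub>R d"
  have "0 \<le> bregman r q" "bregman r p \<le> M / 2 * (norm (r - p))\<^sup>2" "bregman p q \<le> M / 2 * (norm (p - q))\<^sup>2"
    using bregman_nonneg bregman_upper by auto
  \<comment> \<open>Three-point identity. The linear term is \<open>- (norm d)\<^sup>2 / M\<close>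
    and the quadratic model at \<open>p\<close> gives back at most half of it, so
    \<open>(norm d)\<^sup>2 / (2 * M) \<le> bregman p q\<close>.\<close>
  moreover have "bregman r q = bregman r p + bregman p q + d \<bullet> (r - p)"
    by (simp add: bregman_def d_def inner_diff algebra_simps)
  moreover have "d \<bullet> (r - p) = - 2 * ((norm d)\<^sup>2 / (2 * M))" "M / 2 * (norm (r - p))\<^sup>2 = (norm d)\<^sup>2 / (2 * M)"
    using \<open>M > 0\<close> by (auto simp: r_def dot_square_norm power_mult_distrib power2_eq_square field_simps)
  ultimately have "(norm d)\<^sup>2 / (2 * M) \<le> M / 2 * (norm (p - q))\<^sup>2"
    by linarith
  then have "(norm d)\<^sup>2 \<le> (M * norm (p - q))\<^sup>2"
    using \<open>M > 0\<close> by (simp add: field_simps power2_eq_square)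
  then show ?thesis
    unfolding d_def using \<open>M > 0\<close> by (meson power2_le_imp_le mult_nonneg_nonneg norm_ge_zero order_less_imp_le)
qed

text \<open>The increment of \<open>f\<close> is the tangent term at \<open>q\<close> plus a
  divergence lying between 0 and \<open>M / 2 * (norm (p - q))\<^sup>2\<close>.\<close>

lemma abs_diff_le: "\<bar>f p - f q\<bar> \<le> (norm (g q) + M / 2 * norm (p - q)) * norm (p - q)"
proof -
  have "\<bar>g q \<bullet> (p - q)\<bar> \<le> norm (g q) * norm (p - q)"
    by (rule Cauchy_Schwarz_ineq2)
  then show ?thesis
    using bregman_nonneg[of p q] bregman_upper[of p q]
    by (simp add: bregman_def power2_eq_square algebra_simps)
qed

text \<open>The two terms \<open>g (x t) \<bullet> x'\<close> cancel, so only the variation of the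
  gradient survives.\<close>

lemma bregman_has_real_derivative:
  assumes "(x has_vector_derivative x') (at t)"
  shows "((\<lambda>t. bregman p (x t)) has_real_derivative - ((H (x t) *v x') \<bullet> (p - x t))) (at t)"
proof -
  have f: "((\<lambda>t. f (x t)) has_derivative (\<lambda>h. g (x t) \<bullet> (h *\<^sub>R x'))) (at t)"
    using has_derivative_compose[OF assms[unfolded has_vector_derivative_def] grad] by simp
  have g: "((\<lambda>t. g (x t)) has_derivative (\<lambda>h. H (x t) *v (h *\<^sub>R x'))) (at t)"
    using has_derivative_compose[OF assms[unfolded has_vector_derivative_def] hess] by simp
  have "((\<lambda>t. f p - f (x t) - g (x t) \<bullet> (p - x t)) has_derivative
      (\<lambda>h. 0 - g (x t) \<bullet> (h *\<^sub>R x') - (g (x t) \<bullet> (0 - h *\<^sub>R x') + (H (x t) *v (h *\<^sub>R x')) \<bullet> (p - x t)))) (at t)"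
    by (intro has_derivative_diff has_derivative_inner has_derivative_const f g
        assms[unfolded has_vector_derivative_def])
  then show ?thesis
    unfolding bregman_def
    by (rule has_derivative_imp_has_field_derivative) (simp add: matrix_vector_mult_scaleR)
qed

lemma gradient_has_vector_derivative:
  assumes "(x has_vector_derivative x') (at t)"
  shows "((\<lambda>t. g (x t)) has_vector_derivative H (x t) *v x') (at t)"
  using has_derivative_compose[OF assms[unfolded has_vector_derivative_def] hess]
  by (simp add: has_vector_derivative_def matrix_vector_mult_scaleR)

lemma abs_continuous_on_gradient:
  assumes "abs_continuous_on a b x"
  shows "abs_continuous_on a b (\<lambda>t. g (x t))"
  using assms gradient_lipschitz by (rule abs_continuous_on_lipschitz)

lemma abs_continuous_on_bregman:
  assumes x: "abs_continuous_on a b x"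
  shows "abs_continuous_on a b (\<lambda>t. bregman p (x t))"
proof -
  note gx = abs_continuous_on_gradient[OF x]
  obtain B where B: "\<And>t. t \<in> {a..b} \<Longrightarrow> norm (x t) \<le> B"
    using abs_continuous_on_bounded[OF x] by metis
  obtain G where G: "\<And>t. t \<in> {a..b} \<Longrightarrow> norm (g (x t)) \<le> G"
    using abs_continuous_on_bounded[OF gx] by metis
  \<comment> \<open>\<open>f\<close> grows quadratically and has no global Lipschitz constant; the
    bounds \<open>B\<close> and \<open>G\<close> provide one that is valid along the compact
    path.\<close>
  have "abs_continuous_on a b (\<lambda>t. f (x t))"
  proof (rule abs_continuous_on_lipschitz[OF x])
    fix s t assume st: "s \<in> {a..b}" "t \<in> {a..b}"
    have "norm (x t - x s) \<le> 2 * B"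
      using norm_triangle_ineq4[of "x t" "x s"] B[OF st(1)] B[OF st(2)] by linarith
    then have "norm (g (x s)) + M / 2 * norm (x t - x s) \<le> G + M / 2 * (2 * B)"
      using G[OF st(1)] m_pos m_le by (intro add_mono mult_left_mono) auto
    then show "norm (f (x t) - f (x s)) \<le> (G + M / 2 * (2 * B)) * norm (x t - x s)"
      using abs_diff_le[of "x t" "x s"] unfolding real_norm_def
      by (meson mult_right_mono norm_ge_zero order_trans)
  qed
  then show ?thesis
    unfolding bregman_def
    by (intro abs_continuous_on_diff abs_continuous_on_inner abs_continuous_on_const gx x)
qed

end

subsection \<open>Graph Laplacian\<close>

lemma sq_norm_add_le: "(norm (p + q))\<^sup>2 \<le> 2 * (norm p)\<^sup>2 + 2 * (norm q)\<^sup>2"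
proof -
  have "(norm (p + q))\<^sup>2 \<le> (norm p + norm q)\<^sup>2"
    by (simp add: norm_triangle_ineq power_mono)
  also have "\<dots> \<le> 2 * (norm p)\<^sup>2 + 2 * (norm q)\<^sup>2"
    using zero_le_power2[of "norm p - norm q"] unfolding power2_sum power2_diff by linarith
  finally show ?thesis .
qed

definition laplacian :: "('n::finite \<Rightarrow> 'n \<Rightarrow> real) \<Rightarrow> real^'d^'n \<Rightarrow> 'n \<Rightarrow> real^'d" where
  "laplacian a x i = (\<Sum>j\<in>UNIV. a i j *\<^sub>R (x $ i - x $ j))"

text \<open>Ordered pairs are summed, so every edge counts twice; this is the origin of the halves
  that accompany it.\<close>

definition edge_energy :: "('n::finite \<Rightarrow> 'n \<Rightarrow> real) \<Rightarrow> real^'d^'n \<Rightarrow> real" where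
  "edge_energy a x = (\<Sum>i\<in>UNIV. \<Sum>j\<in>UNIV. a i j * (norm (x $ i - x $ j))\<^sup>2)"

text \<open>Summation by parts on the graph: exchange \<open>i\<close> and \<open>j\<close> and
  average. It serves the linear coupling and the sign coupling alike, since both are
  antisymmetric.\<close>

lemma sum_inner_antisymmetric:
  fixes u :: "'n::finite \<Rightarrow> 'a::real_inner"
  assumes sym: "\<And>i j. a i j = a j i" and anti: "\<And>i j. c j i = - c i j"
  shows "(\<Sum>i\<in>UNIV. u i \<bullet> (\<Sum>j\<in>UNIV. a i j *\<^sub>R c i j))
    = (\<Sum>i\<in>UNIV. \<Sum>j\<in>UNIV. a i j * ((u i - u j) \<bullet> c i j)) / 2" (is "?S = _")
proof -
  have S1: "?S = (\<Sum>i\<in>UNIV. \<Sum>j\<in>UNIV. a i j * (u i \<bullet> c i j))"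
    by (simp add: inner_sum_right)
  also have "\<dots> = (\<Sum>i\<in>UNIV. \<Sum>j\<in>UNIV. a j i * (u j \<bullet> c j i))"
    by (rule sum.swap)
  also have "\<dots> = (\<Sum>i\<in>UNIV. \<Sum>j\<in>UNIV. - (a i j * (u j \<bullet> c i j)))"
    by (intro sum.cong refl) (subst sym, subst anti, simp)
  finally have "?S + ?S = (\<Sum>i\<in>UNIV. \<Sum>j\<in>UNIV. a i j * (u i \<bullet> c i j))
      + (\<Sum>i\<in>UNIV. \<Sum>j\<in>UNIV. - (a i j * (u j \<bullet> c i j)))"
    using S1 by linarith
  also have "\<dots> = (\<Sum>i\<in>UNIV. \<Sum>j\<in>UNIV. a i j * ((u i - u j) \<bullet> c i j))"
    by (simp add: sum.distrib[symmetric] inner_diff_left algebra_simps)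
  finally show ?thesis by simp
qed

text \<open>Pairing the sum with itself puts the constant family \<open>s\<close> into the summation
  by parts, where its differences vanish.\<close>

lemma sum_antisymmetric:
  fixes c :: "'n::finite \<Rightarrow> 'n \<Rightarrow> 'a::real_inner"
  assumes "\<And>i j. a i j = a j i" "\<And>i j. c j i = - c i j"
  shows "(\<Sum>i\<in>UNIV. \<Sum>j\<in>UNIV. a i j *\<^sub>R c i j) = 0" (is "?s = 0")
proof -
  define s where "s = ?s"
  have "s \<bullet> ?s = (\<Sum>i\<in>UNIV. s \<bullet> (\<Sum>j\<in>UNIV. a i j *\<^sub>R c i j))"
    by (rule inner_sum_right)
  also have "\<dots> = (\<Sum>i\<in>UNIV. \<Sum>j\<in>UNIV. a i j * ((s - s) \<bullet> c i j)) / 2"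
    by (rule sum_inner_antisymmetric[OF assms])
  finally have "?s \<bullet> ?s = 0"
    unfolding s_def by (simp only: diff_self inner_zero_left mult_zero_right sum.neutral_const div_0)
  then show ?thesis by (simp only: inner_eq_zero_iff)
qed

lemma sum_laplacian:
  assumes "\<And>i j. a i j = a j i"
  shows "(\<Sum>i\<in>UNIV. laplacian a x i) = 0"
  unfolding laplacian_def by (rule sum_antisymmetric[OF assms]) simp

lemma sum_inner_laplacian:
  assumes "\<And>i j. a i j = a j i"
  shows "(\<Sum>i\<in>UNIV. (x $ i - p) \<bullet> laplacian a x i) = edge_energy a x / 2"
proof -
  have "(\<Sum>i\<in>UNIV. (x $ i - p) \<bullet> laplacian a x i)
      = (\<Sum>i\<in>UNIV. \<Sum>j\<in>UNIV. a i j * ((x $ i - p - (x $ j - p)) \<bullet> (x $ i - x $ j))) / 2"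
    unfolding laplacian_def by (rule sum_inner_antisymmetric[OF assms]) simp
  then show ?thesis
    by (simp add: edge_energy_def power2_norm_eq_inner)
qed

text \<open>Induction along the path: each of its edges has weight 1, so its squared difference is
  one summand of a nonnegative total. The constant depends on the path alone and is therefore chosen
  before \<open>X\<close>.\<close>

lemma rtranclp_sq_dist_le_edge_sum:
  fixes a :: "'n::finite \<Rightarrow> 'n \<Rightarrow> real"
  assumes nonneg: "\<And>p q. 0 \<le> a p q"
    and "(\<lambda>p q. a p q = 1)\<^sup>*\<^sup>* i j"
  shows "\<exists>K\<ge>0. \<forall>X :: 'n \<Rightarrow> 'a::real_normed_vector.
    (norm (X j - X i))\<^sup>2 \<le> K * (\<Sum>p\<in>UNIV. \<Sum>q\<in>UNIV. a p q * (norm (X p - X q))\<^sup>2)"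
  using assms(2)
proof induction
  case base
  show ?case by (intro exI[of _ 0]) auto
next
  case (step j k)
  then obtain K where K: "K \<ge> 0" "\<And>X :: 'n \<Rightarrow> 'a. (norm (X j - X i))\<^sup>2 \<le> K * (\<Sum>p\<in>UNIV. \<Sum>q\<in>UNIV. a p q * (norm (X p - X q))\<^sup>2)"
    by blast
  show ?case
  proof (intro exI[of _ "2 * K + 2"] conjI allI)
    fix X :: "'n \<Rightarrow> 'a"
    let ?Q = "\<Sum>p\<in>UNIV. \<Sum>q\<in>UNIV. a p q * (norm (X p - X q))\<^sup>2"
    have "(norm (X j - X k))\<^sup>2 \<le> (\<Sum>q\<in>UNIV. a j q * (norm (X j - X q))\<^sup>2)"
      using member_le_sum[of k UNIV "\<lambda>q. a j q * (norm (X j - X q))\<^sup>2"] step.hyps(2) nonneg by auto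
    also have "\<dots> \<le> ?Q"
      by (rule member_le_sum[of j UNIV "\<lambda>p. \<Sum>q\<in>UNIV. a p q * (norm (X p - X q))\<^sup>2"])
        (auto intro!: sum_nonneg mult_nonneg_nonneg nonneg)
    finally have jk: "(norm (X j - X k))\<^sup>2 \<le> ?Q" .
    have "(norm (X k - X i))\<^sup>2 \<le> 2 * (norm (X j - X i))\<^sup>2 + 2 * (norm (X j - X k))\<^sup>2"
      using sq_norm_add_le[of "X k - X j" "X j - X i"] by (simp add: norm_minus_commute)
    also have "\<dots> \<le> (2 * K + 2) * ?Q"
      using K(2)[of X] jk by (simp add: algebra_simps)
    finally show "(norm (X k - X i))\<^sup>2 \<le> (2 * K + 2) * ?Q" .
  qed (use K in auto)
qed

text \<open>A Poincare inequality relative to the node \<open>r\<close>. Adding up the path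
  constants of all nodes gives one constant for every \<open>i\<close>.\<close>

lemma graph_connected_edge_energy:
  fixes a :: "'n::finite \<Rightarrow> 'n \<Rightarrow> real"
  assumes nonneg: "\<And>i j. 0 \<le> a i j" and "graph_connected a"
  obtains K where "0 \<le> K" "\<And>(x :: real^'d::finite^'n) i. (norm (x $ i - x $ r))\<^sup>2 \<le> K * edge_energy a x"
proof -
  have "\<exists>K\<ge>0. \<forall>x :: real^'d^'n. (norm (x $ i - x $ r))\<^sup>2 \<le> K * edge_energy a x" for i
  proof -
    have "(\<lambda>p q. a p q = 1)\<^sup>*\<^sup>* r i"
      using assms(2) by (auto simp: graph_connected_def)
    from rtranclp_sq_dist_le_edge_sum[OF nonneg this, where ?'a = "real^'d"] obtain K where "K \<ge> 0" and
      K: "\<And>X :: 'n \<Rightarrow> real^'d. (norm (X i - X r))\<^sup>2 \<le> K * (\<Sum>p\<in>UNIV. \<Sum>q\<in>UNIV. a p q * (norm (X p - X q))\<^sup>2)"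
      by blast
    then show ?thesis
      using K[of "($) x" for x] unfolding edge_energy_def by blast
  qed
  then obtain k where k: "\<And>i. 0 \<le> k i"
    "\<And>i (x :: real^'d^'n). (norm (x $ i - x $ r))\<^sup>2 \<le> k i * edge_energy a x"
    by metis
  show thesis
  proof (rule that[of "sum k UNIV"])
    fix x :: "real^'d^'n" and i
    have "k i \<le> sum k UNIV"
      using k(1) by (intro member_le_sum) auto
    moreover have "0 \<le> edge_energy a x"
      unfolding edge_energy_def using nonneg by (intro sum_nonneg mult_nonneg_nonneg) auto
    ultimately show "(norm (x $ i - x $ r))\<^sup>2 \<le> sum k UNIV * edge_energy a x"
      using k(2)[of x i] by (meson mult_right_mono order_trans)
  qed (use k in \<open>auto intro: sum_nonneg\<close>)
qed

subsection \<open>The Filippov set of the HISO field\<close>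

text \<open>Near \<open>s\<close> the field stays in the half-space
  \<open>w \<bullet> y \<le> h s + e\<close>, which is closed and convex, so hull and closure stay
  there too. Thus the Filippov set need not be computed: test vectors \<open>w\<close> with
  continuous majorants \<open>h\<close> extract the facts about it.\<close>

lemma filippov_inner_le:
  assumes y': "y' \<in> filippov F s" and le: "\<And>u. w \<bullet> F u \<le> h u" and cont: "isCont h s"
  shows "w \<bullet> y' \<le> h s"
proof (rule field_le_epsilon)
  fix e :: real assume "e > 0"
  then obtain d where "d > 0" and d: "\<And>u. dist u s < d \<Longrightarrow> dist (h u) (h s) < e"
    using cont unfolding continuous_at_eps_delta by blast
  \<comment> \<open>The removed null set is taken empty because \<open>le\<close> holds at every
    point.\<close>
  have "closure (convex hull (F ` (ball s d - {}))) \<subseteq> {y. w \<bullet> y \<le> h s + e}"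
  proof (intro closure_minimal hull_minimal)
    show "F ` (ball s d - {}) \<subseteq> {y. w \<bullet> y \<le> h s + e}"
    proof clarsimp
      fix u assume "dist s u < d"
      then have "h u < h s + e" using d[of u] by (simp add: dist_commute dist_real_def abs_less_iff)
      then show "w \<bullet> F u \<le> h s + e" using le[of u] by simp
    qed
  qed (simp_all add: convex_halfspace_le closed_halfspace_le)
  moreover have "y' \<in> closure (convex hull (F ` (ball s d - {})))"
    using y' \<open>d > 0\<close> unfolding filippov_def by blast
  ultimately show "w \<bullet> y' \<le> h s + e" by auto
qed

text \<open>Coercivity forces a trivial kernel, which makes a square matrix invertible.\<close>

lemma coercive_matrix_inv_right:
  fixes A :: "real^'d^'d"
  assumes "0 < m" and "\<And>h. m * (h \<bullet> h) \<le> h \<bullet> (A *v h)"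
  shows "A *v (matrix_inv A *v b) = b"
proof -
  have "h = 0" if "A *v h = 0" for h
    using assms(1) assms(2)[of h] that
    by (metis inner_eq_zero_iff inner_ge_zero inner_zero_right linorder_not_less mult_pos_pos order_less_le)
  then have "invertible A"
    by (metis invertible_left_inverse matrix_left_invertible_ker)
  then show ?thesis
    unfolding invertible_def matrix_inv_def
    by (metis (mono_tags, lifting) matrix_vector_mul_assoc matrix_vector_mul_lid someI_ex)
qed

text \<open>Coercivity uniform in \<open>u\<close> bounds the error \<open>y u - y s\<close> by the
  residual of \<open>y s\<close> in the system at \<open>u\<close>, and this residual tends to
  zero.\<close>

lemma isCont_coercive_matrix_inv:
  fixes A :: "'a::metric_space \<Rightarrow> real^'d^'d"
  assumes "0 < m" and coer: "\<And>u h. m * (h \<bullet> h) \<le> h \<bullet> (A u *v h)"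
    and A: "isCont A s" and b: "isCont b s"
  shows "isCont (\<lambda>u. matrix_inv (A u) *v b u) s"
proof -
  define y where "y = (\<lambda>u. matrix_inv (A u) *v b u)"
  have Ay: "A u *v y u = b u" for u
    unfolding y_def using assms(1,2) by (rule coercive_matrix_inv_right)
  have le: "norm (y u - y s) \<le> norm (b u - A u *v y s) / m" for u
  proof (cases "y u = y s")
    case False
    have "m * (norm (y u - y s))\<^sup>2 \<le> (y u - y s) \<bullet> (A u *v (y u - y s))"
      using coer[of "y u - y s" u] by (simp add: power2_norm_eq_inner)
    also have "\<dots> \<le> norm (y u - y s) * norm (b u - A u *v y s)"
      unfolding matrix_vector_mult_diff_distrib Ay by (rule norm_cauchy_schwarz)
    finally have "m * norm (y u - y s) \<le> norm (b u - A u *v y s)"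
      using False by (simp add: power2_eq_square)
    then show ?thesis using \<open>0 < m\<close> by (simp add: field_simps)
  qed (use \<open>0 < m\<close> in simp)
  have "((\<lambda>u. A u *v y s) \<longlongrightarrow> A s *v y s) (at s)"
    using A unfolding isCont_def matrix_vector_mult_def
    by (intro tendsto_intros tendsto_vec_lambda) auto
  then have "((\<lambda>u. norm (b u - A u *v y s) / m) \<longlongrightarrow> norm (b s - A s *v y s) / m) (at s)"
    using b \<open>0 < m\<close> unfolding isCont_def by (intro tendsto_intros) auto
  then have "((\<lambda>u. norm (b u - A u *v y s) / m) \<longlongrightarrow> 0) (at s)"
    by (simp add: Ay)
  then have "((\<lambda>u. y u - y s) \<longlongrightarrow> 0) (at s)"
    by (rule Lim_null_comparison[rotated]) (use le in auto)
  then show ?thesis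
    unfolding isCont_def y_def[symmetric] by (simp add: LIM_zero_iff)
qed

text \<open>A component on the left is positive only for opposite signs, and then
  \<open>\<bar>p $ k\<bar> \<le> \<bar>p $ k - q $ k\<bar>\<close>. The bound is continuous in
  \<open>q\<close> and vanishes at \<open>q = p\<close>, so it can serve as a majorant across the
  jumps of \<open>vsgn\<close>.\<close>

lemma inner_vsgn_ge: "- (p \<bullet> vsgn q) \<le> (\<Sum>k\<in>UNIV. \<bar>p $ k - q $ k\<bar>)"
proof -
  have "- (p $ k * sgn (q $ k)) \<le> \<bar>p $ k - q $ k\<bar>" for k
    by (cases "q $ k" "0 :: real" rule: linorder_cases) auto
  then show ?thesis
    unfolding vsgn_def inner_vec_def by (simp add: sum_negf[symmetric] sum_mono)
qed

lemma vsgn_minus: "vsgn (- q) = - vsgn q"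
  by (simp add: vsgn_def vec_eq_iff sgn_minus)

text \<open>Each conclusion comes from one test vector: the \<open>x\<close> part of the field is
  continuous and hence single-valued, the sum of the \<open>v\<close> part is identically zero, and
  the sign coupling dissipates in the direction of \<open>z\<close>.\<close>

lemma filippov_hiso_field:
  fixes a :: "'n::finite \<Rightarrow> 'n \<Rightarrow> real" and x v x' v' :: "real^'d::finite^'n"
  assumes nonneg: "\<And>i j. 0 \<le> a i j" and sym: "\<And>i j. a i j = a j i"
    and g: "\<And>i y. isCont (g i) y" and H: "\<And>i y. isCont (H i) y"
    and m: "\<And>i. 0 < m i" and coercive: "\<And>i y h. m i * (h \<bullet> h) \<le> h \<bullet> (H i y *v h)"
    and mem: "(x', v') \<in> filippov (hiso_field a g H) (x, v)"
  shows "H i (x $ i) *v (x' $ i) = - (hiso_z g x v i + laplacian a x i)"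
    and "(\<Sum>i\<in>UNIV. v' $ i) = 0"
    and "(\<Sum>i\<in>UNIV. hiso_z g x v i \<bullet> (v' $ i - laplacian a x i)) \<le> 0"
proof -
  define F where "F = hiso_field a g H"
  define z where "z = (\<lambda>(u :: (real^'d^'n) \<times> (real^'d^'n)) i. hiso_z g (fst u) (snd u) i)"
  have fstF: "fst (F u) = (\<chi> i. - (matrix_inv (H i (fst u $ i)) *v (z u i + laplacian a (fst u) i)))" for u
    by (simp add: F_def hiso_field_def Let_def z_def laplacian_def)
  have sndF: "snd (F u) $ i = - (\<Sum>j\<in>UNIV. a i j *\<^sub>R vsgn (z u i - z u j)) + laplacian a (fst u) i" for u i
    by (simp add: F_def hiso_field_def Let_def z_def laplacian_def)
  have inner_snd: "(0 :: real^'d^'n, \<chi> i. w i) \<bullet> y = (\<Sum>i\<in>UNIV. w i \<bullet> snd y $ i)" for w :: "'n \<Rightarrow> real^'d" and y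
    unfolding inner_prod_def fst_conv snd_conv inner_zero_left add_0 by (subst inner_vec_def) simp
  have cx: "isCont (\<lambda>u. fst u $ i) s" and cv: "isCont (\<lambda>u. snd u $ i) s"
    for i and s :: "(real^'d^'n) \<times> (real^'d^'n)"
    by (intro continuous_intros)+
  have cz: "isCont (\<lambda>u. z u i) s" for i s
    unfolding z_def hiso_z_def using cx cv by (intro continuous_intros isCont_o2[OF _ g])
  have cL: "isCont (\<lambda>u. laplacian a (fst u) i) s" for i and s :: "(real^'d^'n) \<times> (real^'d^'n)"
    unfolding laplacian_def using cx by (intro continuous_intros)
  have cF: "isCont (\<lambda>u. fst (F u)) s" for s
  proof -
    have "isCont (\<lambda>u. matrix_inv (H i (fst u $ i)) *v (z u i + laplacian a (fst u) i)) s" for i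
      using m coercive isCont_o2[OF cx H] isCont_add[OF cz cL]
      by (rule isCont_coercive_matrix_inv[of "m i"])
    then show ?thesis
      unfolding fstF isCont_def by (intro tendsto_vec_lambda tendsto_minus)
  qed
  have mem': "(x', v') \<in> filippov F (x, v)"
    using mem by (simp add: F_def)
  \<comment> \<open>The deviation itself is the test vector, so the resulting bound reads
    \<open>p \<bullet> p \<le> 0\<close>.\<close>
  define p where "p = x' - fst (F (x, v))"
  have "(p, 0) \<bullet> (x', v') \<le> p \<bullet> fst (F (x, v))"
    by (rule filippov_inner_le[OF mem']) (auto simp: inner_prod_def intro!: continuous_intros cF)
  then have "p \<bullet> p \<le> 0"
    by (simp add: p_def inner_diff_right)
  then have "p = 0"
    by (metis inner_gt_zero_iff not_le)
  then have "x' = fst (F (x, v))"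
    by (simp add: p_def)
  then have "x' $ i = - (matrix_inv (H i (x $ i)) *v (z (x, v) i + laplacian a x i))"
    by (simp add: fstF)
  then show "H i (x $ i) *v (x' $ i) = - (hiso_z g x v i + laplacian a x i)"
    using coercive_matrix_inv_right[OF m coercive, of i]
    by (simp add: z_def linear_neg[OF matrix_vector_mul_linear])
  \<comment> \<open>Again the deviation is tested against itself, now copied to all nodes; by
    antisymmetry its pairing with the field is zero everywhere.\<close>
  define q where "q = (\<Sum>i\<in>UNIV. v' $ i)"
  have sumF: "(\<Sum>i\<in>UNIV. snd (F u) $ i) = 0" for u
  proof -
    have "(\<Sum>i\<in>UNIV. \<Sum>j\<in>UNIV. a i j *\<^sub>R vsgn (z u i - z u j)) = 0"
      by (rule sum_antisymmetric[OF sym]) (metis minus_diff_eq vsgn_minus)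
    then show ?thesis
      by (simp add: sndF sum_subtractf sum_laplacian[OF sym])
  qed
  have "(0, \<chi> i. q) \<bullet> F u \<le> 0" for u
    unfolding inner_snd inner_sum_right[symmetric] sumF by simp
  then have "(0, \<chi> i. q) \<bullet> (x', v') \<le> 0"
    by (rule filippov_inner_le[OF mem' _ continuous_const])
  then have "q \<bullet> q \<le> 0"
    unfolding inner_snd inner_sum_right[symmetric] by (simp add: q_def)
  then show "(\<Sum>i\<in>UNIV. v' $ i) = 0"
    unfolding q_def by (metis inner_gt_zero_iff not_le)
  define z0 where "z0 = z (x, v)"
  \<comment> \<open>\<open>z0\<close> stays frozen while \<open>u\<close> varies; at
    \<open>u = (x, v)\<close> the absolute values vanish and only the Laplacian term
    remains.\<close>
  define h where "h = (\<lambda>u. (\<Sum>i\<in>UNIV. z0 i \<bullet> laplacian a (fst u) i)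
    + (\<Sum>i\<in>UNIV. \<Sum>j\<in>UNIV. a i j * (\<Sum>k\<in>UNIV. \<bar>(z0 i - z0 j) $ k - (z u i - z u j) $ k\<bar>)) / 2)"
  have "(0, \<chi> i. z0 i) \<bullet> (x', v') \<le> h (x, v)"
  proof (rule filippov_inner_le[OF mem'])
    show "isCont h (x, v)"
      unfolding h_def by (intro continuous_intros cz cL) auto
    fix u
    have "(0, \<chi> i. z0 i) \<bullet> F u = (\<Sum>i\<in>UNIV. z0 i \<bullet> laplacian a (fst u) i)
        - (\<Sum>i\<in>UNIV. z0 i \<bullet> (\<Sum>j\<in>UNIV. a i j *\<^sub>R vsgn (z u i - z u j)))"
      unfolding inner_snd sndF by (simp add: inner_diff_right sum_subtractf)
    also have "(\<Sum>i\<in>UNIV. z0 i \<bullet> (\<Sum>j\<in>UNIV. a i j *\<^sub>R vsgn (z u i - z u j)))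
        = (\<Sum>i\<in>UNIV. \<Sum>j\<in>UNIV. a i j * ((z0 i - z0 j) \<bullet> vsgn (z u i - z u j))) / 2"
      by (rule sum_inner_antisymmetric[OF sym]) (metis minus_diff_eq vsgn_minus)
    also have "(\<Sum>i\<in>UNIV. z0 i \<bullet> laplacian a (fst u) i) - \<dots> = (\<Sum>i\<in>UNIV. z0 i \<bullet> laplacian a (fst u) i)
        + (\<Sum>i\<in>UNIV. \<Sum>j\<in>UNIV. a i j * - ((z0 i - z0 j) \<bullet> vsgn (z u i - z u j))) / 2"
      by (simp add: sum_negf)
    also have "\<dots> \<le> h u"
      unfolding h_def
      by (intro add_left_mono divide_right_mono sum_mono mult_left_mono inner_vsgn_ge nonneg) auto
    finally show "(0, \<chi> i. z0 i) \<bullet> F u \<le> h u" .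
  qed
  then show "(\<Sum>i\<in>UNIV. hiso_z g x v i \<bullet> (v' $ i - laplacian a x i)) \<le> 0"
    unfolding inner_snd snd_conv h_def z0_def z_def by (simp add: inner_diff_right sum_subtractf)
qed

subsection \<open>Convergence\<close>

text \<open>Strong monotonicity bounds \<open>x $ r - p\<close> by the total gradient at
  \<open>x $ r\<close>. That gradient is the sum of the \<open>z i\<close> plus gradient
  differences, which Lipschitz continuity and the Poincare inequality bound by the edge energy; the
  latter also carries the bound from \<open>r\<close> to the other nodes.\<close>

lemma minimizer_error_bound:
  fixes a :: "'n::finite \<Rightarrow> 'n \<Rightarrow> real" and f :: "'n \<Rightarrow> real^'d::finite \<Rightarrow> real"
  assumes nonneg: "\<And>i j. 0 \<le> a i j" and conn: "graph_connected a"
    and bh: "\<And>i. bounded_hessian (f i) (g i) (H i) (m i) (M i)"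
    and stat: "(\<Sum>i\<in>UNIV. g i p) = 0"
  obtains C D where "0 < C" "0 \<le> D" "\<And>(x :: real^'d^'n) v. (\<Sum>i\<in>UNIV. v $ i) = 0 \<Longrightarrow>
    (\<Sum>i\<in>UNIV. (norm (x $ i - p))\<^sup>2) \<le> C * edge_energy a x + D * (\<Sum>i\<in>UNIV. (norm (hiso_z g x v i))\<^sup>2)"
proof -
  \<comment> \<open>Any node can be the reference; \<open>undefined\<close> names one.\<close>
  define r :: 'n where "r = undefined"
  obtain K where "0 \<le> K" and K: "\<And>(x :: real^'d^'n) i. (norm (x $ i - x $ r))\<^sup>2 \<le> K * edge_energy a x"
    using graph_connected_edge_energy[OF nonneg conn] by metis
  define \<mu> where "\<mu> = sum m UNIV"
  define L where "L = sum M UNIV"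
  define N where "N = real CARD('n)"
  have m_pos: "0 < m i" and M_pos: "0 < M i" for i
    using bounded_hessian.m_pos[OF bh, of i] bounded_hessian.m_le[OF bh, of i] by auto
  have "0 < \<mu>" unfolding \<mu>_def using m_pos by (intro sum_pos) auto
  have Q0: "0 \<le> edge_energy a x" for x :: "real^'d^'n"
    unfolding edge_energy_def using nonneg by (intro sum_nonneg mult_nonneg_nonneg) auto
  \<comment> \<open>\<open>C\<close> and \<open>D\<close> collect the coefficients of the final
    estimate; the extra 1 keeps \<open>C\<close> positive even if \<open>K = 0\<close>.\<close>
  define C where "C = 1 + N * (4 * L\<^sup>2 * K / \<mu>\<^sup>2 + 2 * K)"
  define D where "D = N * (4 * N\<^sup>2 / \<mu>\<^sup>2)"
  show thesis
  proof (rule that[of C D])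
    show "0 < C" unfolding C_def N_def using \<open>0 \<le> K\<close> by (intro add_pos_nonneg) auto
    show "0 \<le> D" unfolding D_def N_def by simp
    fix x v :: "real^'d^'n" assume v: "(\<Sum>i\<in>UNIV. v $ i) = 0"
    define z where "z = hiso_z g x v"
    define V where "V = (\<Sum>i\<in>UNIV. (norm (z i))\<^sup>2)"
    define Q where "Q = edge_energy a x"
    define e where "e = x $ r - p"
    have "V \<ge> 0" unfolding V_def by (simp add: sum_nonneg)
    have "\<mu> * (norm e)\<^sup>2 = (\<Sum>i\<in>UNIV. m i * (norm e)\<^sup>2)"
      by (simp add: \<mu>_def sum_distrib_right)
    also have "\<dots> \<le> (\<Sum>i\<in>UNIV. (g i (x $ r) - g i p) \<bullet> e)"
      unfolding e_def by (intro sum_mono bounded_hessian.gradient_strongly_monotone[OF bh])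
    also have "\<dots> = (\<Sum>i\<in>UNIV. g i (x $ r)) \<bullet> e"
      using stat by (simp add: inner_sum_left[symmetric] sum_subtractf)
    also have "\<dots> \<le> norm (\<Sum>i\<in>UNIV. g i (x $ r)) * norm e"
      by (rule norm_cauchy_schwarz)
    finally have "\<mu> * norm e \<le> norm (\<Sum>i\<in>UNIV. g i (x $ r))"
      by (cases "e = 0") (auto simp: power2_eq_square)
    \<comment> \<open>The zero sum of \<open>v\<close> enters here: it identifies the sums of
      \<open>z i\<close> and of \<open>g i (x $ i)\<close>.\<close>
    also have "(\<Sum>i\<in>UNIV. g i (x $ r)) = (\<Sum>i\<in>UNIV. z i) + (\<Sum>i\<in>UNIV. g i (x $ r) - g i (x $ i))"
      using v by (simp add: z_def hiso_z_def sum.distrib sum_subtractf)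
    also have "norm \<dots> \<le> norm (\<Sum>i\<in>UNIV. z i) + norm (\<Sum>i\<in>UNIV. g i (x $ r) - g i (x $ i))"
      by (rule norm_triangle_ineq)
    also have "\<dots> \<le> N * sqrt V + L * sqrt (K * Q)"
    proof (rule add_mono)
      have "norm (z i) \<le> sqrt V" for i
        unfolding V_def by (rule real_le_rsqrt, rule member_le_sum) auto
      then show "norm (\<Sum>i\<in>UNIV. z i) \<le> N * sqrt V"
        unfolding N_def by (intro order_trans[OF norm_sum] order_trans[OF sum_bounded_above]) auto
      have "norm (g i (x $ r) - g i (x $ i)) \<le> M i * sqrt (K * Q)" for i
      proof -
        have "norm (x $ r - x $ i) \<le> sqrt (K * Q)"
          unfolding Q_def using K[of x i] by (intro real_le_rsqrt) (simp add: norm_minus_commute)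
        then show ?thesis
          using bounded_hessian.gradient_lipschitz[OF bh, of i "x $ r" "x $ i"] M_pos[of i]
          by (meson mult_left_mono order_less_imp_le order_trans)
      qed
      then show "norm (\<Sum>i\<in>UNIV. g i (x $ r) - g i (x $ i)) \<le> L * sqrt (K * Q)"
        unfolding L_def sum_distrib_right by (intro order_trans[OF norm_sum] sum_mono)
    qed
    finally have "(\<mu> * norm e)\<^sup>2 \<le> (N * sqrt V + L * sqrt (K * Q))\<^sup>2"
      using \<open>0 < \<mu>\<close> by (intro power_mono) auto
    also have "\<dots> \<le> 2 * (N * sqrt V)\<^sup>2 + 2 * (L * sqrt (K * Q))\<^sup>2"
      using sq_norm_add_le[of "N * sqrt V" "L * sqrt (K * Q)"] by simp
    also have "\<dots> = 2 * N\<^sup>2 * V + 2 * L\<^sup>2 * K * Q"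
      using \<open>V \<ge> 0\<close> \<open>0 \<le> K\<close> Q0[of x] by (simp add: power_mult_distrib Q_def)
    finally have e: "(norm e)\<^sup>2 \<le> (2 * N\<^sup>2 * V + 2 * L\<^sup>2 * K * Q) / \<mu>\<^sup>2"
      using \<open>0 < \<mu>\<close> by (simp add: field_simps power_mult_distrib)
    have "(norm (x $ i - p))\<^sup>2 \<le> 2 * (norm e)\<^sup>2 + 2 * (K * Q)" for i
      using sq_norm_add_le[of e "x $ i - x $ r"] K[of x i] by (simp add: e_def Q_def)
    also have "\<dots> \<le> 2 * ((2 * N\<^sup>2 * V + 2 * L\<^sup>2 * K * Q) / \<mu>\<^sup>2) + 2 * (K * Q)"
      using e by linarith
    finally have "(\<Sum>i\<in>UNIV. (norm (x $ i - p))\<^sup>2)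
        \<le> N * (2 * ((2 * N\<^sup>2 * V + 2 * L\<^sup>2 * K * Q) / \<mu>\<^sup>2) + 2 * (K * Q))"
      unfolding N_def by (intro sum_bounded_above) auto
    also have "\<dots> = (C - 1) * Q + D * V"
      unfolding C_def D_def using \<open>0 < \<mu>\<close> by (simp add: field_simps)
    also have "\<dots> \<le> C * Q + D * V"
      using Q0[of x] by (simp add: Q_def algebra_simps)
    finally show "(\<Sum>i\<in>UNIV. (norm (x $ i - p))\<^sup>2) \<le> C * edge_energy a x
        + D * (\<Sum>i\<in>UNIV. (norm (hiso_z g x v i))\<^sup>2)"
      by (simp add: Q_def V_def z_def)
  qed
qed

theorem theorem2:
  fixes a :: "'n::finite \<Rightarrow> 'n \<Rightarrow> real"
    and f :: "'n \<Rightarrow> real^'d::finite \<Rightarrow> real"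
    and g :: "'n \<Rightarrow> real^'d \<Rightarrow> real^'d"
    and H :: "'n \<Rightarrow> real^'d \<Rightarrow> real^'d^'d"
    and m_lo m_hi :: "'n \<Rightarrow> real"
    and xstar :: "real^'d"
    and x v :: "real \<Rightarrow> real^'d^'n"
  assumes adj01: "\<And>i j. a i j = 0 \<or> a i j = 1"
    and adj_sym: "\<And>i j. a i j = a j i"
    and adj_irrefl: "\<And>i. a i i = 0"
    and conn: "graph_connected a"
    and grad: "\<And>i y. (f i has_derivative (\<lambda>h. g i y \<bullet> h)) (at y)"
    and hess: "\<And>i y. (g i has_derivative (\<lambda>h. H i y *v h)) (at y)"
    and hess_cont: "\<And>i. continuous_on UNIV (H i)"
    and m_pos: "\<And>i. 0 < m_lo i"
    and m_le: "\<And>i. m_lo i \<le> m_hi i"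
    and hess_lo: "\<And>i y. loewner_le (m_lo i *\<^sub>R mat 1) (H i y)"
    and hess_hi: "\<And>i y. loewner_le (H i y) (m_hi i *\<^sub>R mat 1)"
    and xstar_min: "\<And>y. (\<Sum>i\<in>UNIV. f i xstar) \<le> (\<Sum>i\<in>UNIV. f i y)"
    and sol: "filippov_solution (hiso_field a g H) (\<lambda>t. (x t, v t))"
    and v0: "(\<Sum>i\<in>UNIV. v 0 $ i) = 0"
  shows "\<forall>i. ((\<lambda>t. x t $ i) \<longlongrightarrow> xstar) at_top \<and>
             ((\<lambda>t. hiso_z g (x t) (v t) i) \<longlongrightarrow> 0) at_top"
proof -
  have nonneg: "\<And>i j. 0 \<le> a i j"
    using adj01 by (metis order_refl zero_le_one)
  have quad: "y \<bullet> ((c *\<^sub>R mat 1) *v y) = c * (y \<bullet> y)" for c and y :: "real^'d"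
    by (simp add: scaleR_matrix_vector_assoc[symmetric])
  have lo: "m_lo i * (h \<bullet> h) \<le> h \<bullet> (H i y *v h)" and hi: "h \<bullet> (H i y *v h) \<le> m_hi i * (h \<bullet> h)" for i y h
    using hess_lo[of i y] hess_hi[of i y] by (auto simp: loewner_le_def quad)
  have bh: "bounded_hessian (f i) (g i) (H i) (m_lo i) (m_hi i)" for i
    by unfold_locales (rule grad hess m_pos m_le lo hi)+
  have g_cont: "isCont (g i) y" for i y
    using hess has_derivative_continuous by blast
  have H_cont: "isCont (H i) y" for i y
    using hess_cont[of i] by (simp add: continuous_on_eq_continuous_at)
  define z where "z = (\<lambda>t. hiso_z g (x t) (v t))"
  define B where "B = (\<lambda>i. bounded_hessian.bregman (f i) (g i) xstar)"

  \<comment> \<open>Stationarity of the minimizer\<close>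
  have stat: "(\<Sum>i\<in>UNIV. g i xstar) = 0"
  proof -
    have "((\<lambda>y. \<Sum>i\<in>UNIV. f i y) has_derivative (\<lambda>h. \<Sum>i\<in>UNIV. g i xstar \<bullet> h)) (at xstar)"
      by (intro has_derivative_sum grad)
    then have "(\<lambda>h. \<Sum>i\<in>UNIV. g i xstar \<bullet> h) = (\<lambda>h. 0)"
      by (rule differential_zero_maxmin[OF UNIV_I open_UNIV]) (use xstar_min in auto)
    then have "(\<Sum>i\<in>UNIV. g i xstar) \<bullet> h = 0" for h
      unfolding inner_sum_left by metis
    then show ?thesis
      using inner_eq_zero_iff by blast
  qed

  \<comment> \<open>Regularity and dynamics along the solution\<close>
  obtain Z where Z: "Z \<in> null_sets lebesgue" and sol': "\<And>t. t \<in> {0<..} - Z \<Longrightarrow>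
      \<exists>y'. ((\<lambda>t. (x t, v t)) has_vector_derivative y') (at t) \<and> y' \<in> filippov (hiso_field a g H) (x t, v t)"
    using sol unfolding filippov_solution_def by blast
  have ac: "abs_continuous_on 0 T (\<lambda>t. (x t, v t))" if "T > 0" for T
    using sol that unfolding filippov_solution_def by blast
  have ac_x: "abs_continuous_on 0 T (\<lambda>t. x t $ i)" if "T > 0" for T i
  proof (rule abs_continuous_on_lipschitz[OF ac[OF that], where K = 1])
    fix s t
    have "norm (x t $ i - x s $ i) \<le> norm (x t - x s)"
      using Finite_Cartesian_Product.norm_nth_le[of "x t - x s" i] by simp
    also have "\<dots> \<le> norm ((x t, v t) - (x s, v s))"
      unfolding diff_Pair by (rule norm_fst_le)
    finally show "norm (x t $ i - x s $ i) \<le> 1 * norm ((x t, v t) - (x s, v s))"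
      by simp
  qed
  have ac_v: "abs_continuous_on 0 T (\<lambda>t. v t $ i)" if "T > 0" for T i
  proof (rule abs_continuous_on_lipschitz[OF ac[OF that], where K = 1])
    fix s t
    have "norm (v t $ i - v s $ i) \<le> norm (v t - v s)"
      using Finite_Cartesian_Product.norm_nth_le[of "v t - v s" i] by simp
    also have "\<dots> \<le> norm ((x t, v t) - (x s, v s))"
      unfolding diff_Pair by (rule norm_snd_le)
    finally show "norm (v t $ i - v s $ i) \<le> 1 * norm ((x t, v t) - (x s, v s))"
      by simp
  qed
  have ac_z: "abs_continuous_on 0 T (\<lambda>t. z t i)" if "T > 0" for T i
    unfolding z_def hiso_z_def
    by (intro abs_continuous_on_add bounded_hessian.abs_continuous_on_gradient[OF bh] ac_x ac_v that)

  have dyn: "\<exists>x' v'. (\<forall>i. ((\<lambda>t. x t $ i) has_vector_derivative x' i) (at t)) \<and>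
      (\<forall>i. ((\<lambda>t. v t $ i) has_vector_derivative v' i) (at t)) \<and>
      (\<forall>i. H i (x t $ i) *v x' i = - (z t i + laplacian a (x t) i)) \<and> (\<Sum>i\<in>UNIV. v' i) = 0 \<and>
      (\<Sum>i\<in>UNIV. z t i \<bullet> (v' i - laplacian a (x t) i)) \<le> 0" if "t \<in> {0<..} - Z" for t
  proof -
    obtain x' v' where der: "((\<lambda>t. (x t, v t)) has_vector_derivative (x', v')) (at t)"
      and mem: "(x', v') \<in> filippov (hiso_field a g H) (x t, v t)"
      using sol'[OF \<open>t \<in> {0<..} - Z\<close>] by auto
    have "((\<lambda>t. x t $ i) has_vector_derivative x' $ i) (at t)"
      "((\<lambda>t. v t $ i) has_vector_derivative v' $ i) (at t)" for i
      using bounded_linear.has_vector_derivative[OF bounded_linear_vec_nth[of i]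
          bounded_linear.has_vector_derivative[OF bounded_linear_fst der]]
        bounded_linear.has_vector_derivative[OF bounded_linear_vec_nth[of i]
          bounded_linear.has_vector_derivative[OF bounded_linear_snd der]]
      by simp_all
    moreover note filippov_hiso_field[OF nonneg adj_sym g_cont H_cont m_pos lo mem]
    ultimately show ?thesis
      unfolding z_def by (intro exI[of _ "($) x'"] exI[of _ "($) v'"]) simp
  qed

  have sum_v: "(\<Sum>i\<in>UNIV. v t $ i) = 0" if "t > 0" for t
  proof -
    \<comment> \<open>Freezing the direction at the final time makes the conserved sum scalar; its
      increment from time 0 is then \<open>p \<bullet> p\<close>.\<close>
    define p where "p = (\<Sum>i\<in>UNIV. v t $ i)"
    define \<phi> where "\<phi> = (\<lambda>s. (\<Sum>i\<in>UNIV. v s $ i) \<bullet> p)"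
    have "\<phi> t - \<phi> 0 \<le> 0 * (t - 0)"
    proof (rule abs_continuous_on_DERIV_le[OF _ _ Z])
      show "abs_continuous_on 0 t \<phi>"
        unfolding \<phi>_def
        by (intro abs_continuous_on_inner abs_continuous_on_sum abs_continuous_on_const ac_v that)
      fix s assume "s \<in> {0<..<t} - Z"
      then obtain v' where v': "\<And>i. ((\<lambda>t. v t $ i) has_vector_derivative v' i) (at s)" "(\<Sum>i\<in>UNIV. v' i) = 0"
        using dyn[of s] by auto
      have "((\<lambda>s. \<Sum>i\<in>UNIV. v s $ i) has_vector_derivative (\<Sum>i\<in>UNIV. v' i)) (at s)"
        by (intro has_vector_derivative_sum v')
      then have "(\<phi> has_vector_derivative (\<Sum>i\<in>UNIV. v' i) \<bullet> p) (at s)"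
        unfolding \<phi>_def by (rule bounded_linear.has_vector_derivative[OF bounded_linear_inner_left])
      then show "\<exists>D. (\<phi> has_real_derivative D) (at s) \<and> D \<le> 0"
        unfolding v'(2) has_real_derivative_iff_has_vector_derivative by auto
    qed (use that in simp)
    then have "p \<bullet> p \<le> 0"
      by (simp add: \<phi>_def p_def v0)
    then show ?thesis
      unfolding p_def by (metis inner_gt_zero_iff not_le)
  qed

  \<comment> \<open>The Lyapunov function and its constants\<close>
  obtain C D where "0 < C" "0 \<le> D" and err: "\<And>(x :: real^'d^'n) v. (\<Sum>i\<in>UNIV. v $ i) = 0 \<Longrightarrow>
    (\<Sum>i\<in>UNIV. (norm (x $ i - xstar))\<^sup>2) \<le> C * edge_energy a x + D * (\<Sum>i\<in>UNIV. (norm (hiso_z g x v i))\<^sup>2)"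
    using minimizer_error_bound[OF nonneg conn bh stat] by metis
  define E where "E = (\<lambda>t. \<Sum>i\<in>UNIV. (norm (x t $ i - xstar))\<^sup>2)"
  define V where "V = (\<lambda>t. \<Sum>i\<in>UNIV. (norm (z t i))\<^sup>2)"
  \<comment> \<open>\<open>D / (2 * C)\<close> pays for the \<open>V\<close> term of the error bound
    and \<open>C\<close> for the one from weighted AM-GM.\<close>
  define c where "c = D / (2 * C) + C"
  define L where "L = sum m_hi UNIV"
  \<comment> \<open>The divergences total at most \<open>L / 2 * E t\<close>, so
    \<open>1 / (2 * C * L)\<close> fits them under \<open>E t / (4 * C)\<close>; the 1 handles the
    \<open>V\<close> term.\<close>
  define \<kappa> where "\<kappa> = min 1 (1 / (2 * C * L))"
  define U where "U = (\<lambda>t. (\<Sum>i\<in>UNIV. B i (x t $ i)) + c * V t)"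
  have "0 < c"
    using \<open>0 < C\<close> \<open>0 \<le> D\<close> by (simp add: c_def add_nonneg_pos)
  have hi_pos: "0 < m_hi i" for i
    using m_pos[of i] m_le[of i] by simp
  have "0 < L"
    unfolding L_def using hi_pos by (intro sum_pos) auto
  have "0 < \<kappa>"
    using \<open>0 < C\<close> \<open>0 < L\<close> by (simp add: \<kappa>_def)
  have V0: "0 \<le> V t" and E0: "0 \<le> E t" for t
    by (simp_all add: V_def E_def sum_nonneg)
  have B0: "0 \<le> B i y" for i y
    unfolding B_def by (rule bounded_hessian.bregman_nonneg[OF bh])
  have U0: "0 \<le> U t" for t
    unfolding U_def using B0 V0 \<open>0 < c\<close> by (simp add: sum_nonneg)

  have U_le: "\<kappa> * U t \<le> E t / (4 * C) + c * V t" for t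
  proof -
    have "(\<Sum>i\<in>UNIV. B i (x t $ i)) \<le> (\<Sum>i\<in>UNIV. L / 2 * (norm (x t $ i - xstar))\<^sup>2)"
    proof (rule sum_mono)
      fix i
      have "B i (x t $ i) \<le> m_hi i / 2 * (norm (x t $ i - xstar))\<^sup>2"
        using bounded_hessian.bregman_upper[OF bh, of i xstar "x t $ i"]
        by (simp add: B_def norm_minus_commute)
      also have "\<dots> \<le> L / 2 * (norm (x t $ i - xstar))\<^sup>2"
        unfolding L_def using hi_pos
        by (intro mult_right_mono divide_right_mono member_le_sum) (auto intro: less_imp_le)
      finally show "B i (x t $ i) \<le> L / 2 * (norm (x t $ i - xstar))\<^sup>2" .
    qed
    also have "\<dots> = L / 2 * E t"
      by (simp add: E_def sum_distrib_left)
    finally have "\<kappa> * (\<Sum>i\<in>UNIV. B i (x t $ i)) \<le> 1 / (2 * C * L) * (L / 2 * E t)"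
      using \<open>0 < \<kappa>\<close> E0[of t] \<open>0 < L\<close> \<open>0 < C\<close> B0
      by (intro mult_mono) (auto simp: \<kappa>_def sum_nonneg)
    also have "\<dots> = E t / (4 * C)"
      using \<open>0 < L\<close> by simp
    finally have "\<kappa> * (\<Sum>i\<in>UNIV. B i (x t $ i)) \<le> E t / (4 * C)" .
    moreover have "\<kappa> * (c * V t) \<le> 1 * (c * V t)"
      using V0[of t] \<open>0 < c\<close> by (intro mult_right_mono) (auto simp: \<kappa>_def)
    ultimately show ?thesis
      by (simp add: U_def distrib_left)
  qed

  \<comment> \<open>Decay of the Lyapunov function\<close>
  have lim: "(U \<longlongrightarrow> 0) at_top"
  proof (rule abs_continuous_decay[OF _ U0 \<open>0 < \<kappa>\<close> Z])
    fix T :: real assume "T > 0"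
    have V: "abs_continuous_on 0 T V"
      unfolding V_def power2_norm_eq_inner
      by (intro abs_continuous_on_sum abs_continuous_on_inner ac_z \<open>T > 0\<close>)
    have "abs_continuous_on 0 T (\<lambda>t. c * V t)"
      using abs_continuous_on_inner[OF abs_continuous_on_const[of _ _ c] V] by simp
    then show "abs_continuous_on 0 T U"
      unfolding U_def B_def
      by (intro abs_continuous_on_add abs_continuous_on_sum
          bounded_hessian.abs_continuous_on_bregman[OF bh] ac_x \<open>T > 0\<close>)
  next
    fix t assume t: "t \<in> {0<..} - Z"
    then obtain x' v' where x': "\<And>i. ((\<lambda>t. x t $ i) has_vector_derivative x' i) (at t)"
      and v': "\<And>i. ((\<lambda>t. v t $ i) has_vector_derivative v' i) (at t)"
      and Hx': "\<And>i. H i (x t $ i) *v x' i = - (z t i + laplacian a (x t) i)"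
      and zv': "(\<Sum>i\<in>UNIV. z t i \<bullet> (v' i - laplacian a (x t) i)) \<le> 0"
      using dyn by blast
    \<comment> \<open>The Laplacian coming from \<open>H (x t $ i) *v x' i\<close> is grouped with
      \<open>v' i\<close>, so that \<open>zv'\<close> applies to the bracket as a whole.\<close>
    define z' where "z' = (\<lambda>i. - z t i + (v' i - laplacian a (x t) i))"
    have dz: "((\<lambda>t. z t i) has_vector_derivative z' i) (at t)" for i
    proof -
      have "((\<lambda>t. z t i) has_vector_derivative H i (x t $ i) *v x' i + v' i) (at t)"
        unfolding z_def hiso_z_def
        by (intro has_vector_derivative_add bounded_hessian.gradient_has_vector_derivative[OF bh] x' v')
      then show ?thesis by (simp add: Hx' z'_def algebra_simps)
    qed
    have "((\<lambda>t. (norm (z t i))\<^sup>2) has_real_derivative 2 * (z t i \<bullet> z' i)) (at t)" for i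
      unfolding power2_norm_eq_inner
      by (rule has_derivative_imp_has_field_derivative[OF has_derivative_inner[OF
              dz[unfolded has_vector_derivative_def] dz[unfolded has_vector_derivative_def]]])
        (simp add: inner_commute)
    then have dV: "(V has_real_derivative (\<Sum>i\<in>UNIV. 2 * (z t i \<bullet> z' i))) (at t)"
      unfolding V_def by (intro DERIV_sum)
    have dB: "((\<lambda>t. B i (x t $ i)) has_real_derivative (z t i + laplacian a (x t) i) \<bullet> (xstar - x t $ i)) (at t)" for i
      using bounded_hessian.bregman_has_real_derivative[OF bh x'[of i], of i xstar]
      unfolding B_def Hx' inner_minus_left minus_minus .
    have dU: "(U has_real_derivative (\<Sum>i\<in>UNIV. (z t i + laplacian a (x t) i) \<bullet> (xstar - x t $ i))
        + c * (\<Sum>i\<in>UNIV. 2 * (z t i \<bullet> z' i))) (at t)"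
      unfolding U_def by (intro DERIV_add DERIV_sum DERIV_cmult dB dV)
    have "(\<Sum>i\<in>UNIV. z t i \<bullet> z' i) \<le> - V t"
      using zv' by (simp add: z'_def V_def power2_norm_eq_inner inner_diff_right sum_subtractf)
    then have "c * (\<Sum>i\<in>UNIV. z t i \<bullet> z' i) \<le> c * - V t"
      using \<open>0 < c\<close> by (intro mult_left_mono) auto
    then have V': "c * (\<Sum>i\<in>UNIV. 2 * (z t i \<bullet> z' i)) \<le> - 2 * (c * V t)"
      by (simp add: sum_distrib_left[symmetric])
    have lap: "(\<Sum>i\<in>UNIV. laplacian a (x t) i \<bullet> (xstar - x t $ i)) = - (edge_energy a (x t) / 2)"
      unfolding sum_inner_laplacian[OF adj_sym, of "x t" xstar, symmetric] sum_negf[symmetric]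
      by (simp add: inner_commute inner_diff_right)
    \<comment> \<open>weighted AM-GM, with the weight chosen to absorb half of the dissipation \<open>E / (2 * C)\<close>\<close>
    have young: "z t i \<bullet> (xstar - x t $ i) \<le> C * (norm (z t i))\<^sup>2 + (norm (x t $ i - xstar))\<^sup>2 / (4 * C)" for i
    proof -
      have "0 \<le> (norm ((2 * C) *\<^sub>R z t i + (x t $ i - xstar)))\<^sup>2 / (4 * C)"
        using \<open>0 < C\<close> by simp
      also have "\<dots> = C * (norm (z t i))\<^sup>2 + (norm (x t $ i - xstar))\<^sup>2 / (4 * C) + z t i \<bullet> (x t $ i - xstar)"
        using \<open>0 < C\<close> unfolding power2_norm_eq_inner inner_add
        by (simp add: inner_commute[of "x t $ i - xstar" "z t i"] add_divide_distrib)
      finally show ?thesis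
        by (simp add: inner_diff_right)
    qed
    have "(\<Sum>i\<in>UNIV. z t i \<bullet> (xstar - x t $ i))
        \<le> (\<Sum>i\<in>UNIV. C * (norm (z t i))\<^sup>2 + (norm (x t $ i - xstar))\<^sup>2 / (4 * C))"
      by (intro sum_mono young)
    also have "\<dots> = C * V t + E t / (4 * C)"
      by (simp add: V_def E_def sum.distrib sum_distrib_left sum_divide_distrib)
    finally have cross: "(\<Sum>i\<in>UNIV. z t i \<bullet> (xstar - x t $ i)) \<le> C * V t + E t / (4 * C)" .
    have "E t \<le> C * edge_energy a (x t) + D * V t"
      unfolding E_def V_def z_def using t by (intro err sum_v) auto
    then have "E t / (2 * C) \<le> (C * edge_energy a (x t) + D * V t) / (2 * C)"
      using \<open>0 < C\<close> by (intro divide_right_mono) auto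
    also have "\<dots> = edge_energy a (x t) / 2 + D / (2 * C) * V t"
      using \<open>0 < C\<close> by (simp add: add_divide_distrib)
    finally have diss: "E t / (2 * C) - D / (2 * C) * V t \<le> edge_energy a (x t) / 2"
      by simp
    have "(\<Sum>i\<in>UNIV. (z t i + laplacian a (x t) i) \<bullet> (xstar - x t $ i))
        \<le> c * V t + E t / (4 * C) - E t / (2 * C)"
      using cross diss lap by (simp add: inner_add_left sum.distrib c_def distrib_right)
    moreover have "E t / (2 * C) = 2 * (E t / (4 * C))"
      by simp
    \<comment> \<open>Of the \<open>2 * (c * V t)\<close> dissipated, one half cancels
      \<open>c * V t\<close> from the divergences; the other half and the remaining
      \<open>E t / (4 * C)\<close> dominate \<open>\<kappa> * U t\<close>.\<close>
    ultimately have "(\<Sum>i\<in>UNIV. (z t i + laplacian a (x t) i) \<bullet> (xstar - x t $ i))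
        + c * (\<Sum>i\<in>UNIV. 2 * (z t i \<bullet> z' i)) \<le> - (\<kappa> * U t)"
      using V' U_le[of t] by linarith
    then show "\<exists>D. (U has_real_derivative D) (at t) \<and> D \<le> - \<kappa> * U t"
      using dU by auto
  qed

  \<comment> \<open>Limits of the states\<close>
  show ?thesis
  proof (intro allI conjI)
    fix i
    have "(norm (x t $ i - xstar))\<^sup>2 \<le> 2 / m_lo i * U t" for t
    proof -
      have "m_lo i / 2 * (norm (x t $ i - xstar))\<^sup>2 \<le> B i (x t $ i)"
        using bounded_hessian.bregman_lower[OF bh, of i xstar "x t $ i"]
        by (simp add: B_def norm_minus_commute)
      also have "\<dots> \<le> (\<Sum>i\<in>UNIV. B i (x t $ i))"
        using B0 by (intro member_le_sum) auto
      also have "\<dots> \<le> U t"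
        using V0[of t] \<open>0 < c\<close> by (simp add: U_def)
      finally show ?thesis
        using m_pos[of i] by (simp add: field_simps)
    qed
    then have "((\<lambda>t. x t $ i - xstar) \<longlongrightarrow> 0) at_top"
      by (rule tendsto_0_of_sq_le[OF lim])
    then show "((\<lambda>t. x t $ i) \<longlongrightarrow> xstar) at_top"
      by (rule LIM_zero_cancel)
    have "(norm (z t i))\<^sup>2 \<le> 1 / c * U t" for t
    proof -
      have "(norm (z t i))\<^sup>2 \<le> V t"
        unfolding V_def by (rule member_le_sum) auto
      then have "c * (norm (z t i))\<^sup>2 \<le> c * V t"
        using \<open>0 < c\<close> by simp
      also have "\<dots> \<le> U t"
        using B0 by (simp add: U_def sum_nonneg)
      finally show ?thesis
        using \<open>0 < c\<close> by (simp add: field_simps)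
    qed
    then show "((\<lambda>t. hiso_z g (x t) (v t) i) \<longlongrightarrow> 0) at_top"
      unfolding z_def by (rule tendsto_0_of_sq_le[OF lim])
  qed
qed

end
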